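(* Let $f\in L^2(\mathbb{P}_\eta)$. Then $$\mathbb{E} f(\eta)^2=(\mathbb{E} f(\eta))^2+\sum_{n=1}^\infty\frac{1}{n!}\|T_nf\|_n^2 .$$ If also $g\in L^2(\mathbb{P}_\eta)$, then more generally $$\mathbb{E} f(\eta)g(\eta)=(\mathbb{E} f(\eta))(\mathbb{E} g(\eta))+\sum_{n=1}^\infty\frac{1}{n!}\langle T_nf,T_ng\rangle_n .$$
   Context: Let $(\mathbb{Y},\mathcal{Y})$ be an arbitrary measurable space and $\lambda$ an arbitrary $\sigma$-finite measure on it. Let $\mathbf{N}$ be the space of all $\sigma$-finite measures $\mu$ on $\mathbb{Y}$ with values in $\{0,1,2,\ldots\}\cup\{\infty\}$, equipped with the smallest $\sigma$-field making $\mu\mapsto\mu(B)$ measurable for every $B\in\mathcal{Y}$. On a probability space $(\Omega,\mathcal{F},\mathbb{P})$, $\eta$ is a Poisson process on $\mathbb{Y}$ with intensity measure $\lambda$: a random element of $\mathbf{N}$ such that $\eta(B)$ is Poisson distributed with parameter $\lambda(B)$ for each $B\in\mathcal{Y}$, and $\eta(B_1),\ldots,\eta(B_k)$ are independent for pairwise disjoint $B_1,\ldots,B_k\in\mathcal{Y}$. $\mathbb{P}_\eta$ is the distribution of $\eta$, and $L^2(\mathbb{P}_\eta)$ is the space of measurable $f:\mathbf{N}\to\mathbb{R}$ with $\mathbb{E}f(\eta)^2<\infty$. For measurable $f:\mathbf{N}\to\mathbb{R}$ and $y\in\mathbb{Y}$, $D_yf(\mu):=f(\mu+\delta_y)-f(\mu)$,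 where $\delta_y$ is the Dirac measure at $y$; $D^1:=D$, $D^0f:=f$, and for $n\ge2$, $D^n_{y_1,\ldots,y_n}f:=D^1_{y_1}D^{n-1}_{y_2,\ldots,y_n}f$. For $n\geq 1$, $T_nf(y_1,\ldots,y_n):=\mathbb{E}D^n_{y_1,\ldots,y_n}f(\eta)$ and $T_0f:=\mathbb{E}f(\eta)$, whenever these expectations are defined (for $f\in L^2(\mathbb{P}_\eta)$ this is the case for $\lambda^n$-a.e. $(y_1,\ldots,y_n)$). $\langle\cdot,\cdot\rangle_n$ and $\|\cdot\|_n$ denote the scalar product and norm of $L^2(\lambda^n)$, where $\lambda^n$ is the $n$-fold product measure. *)

theory Defs
  imports "HOL-Probability.Probability"
begin

subsection \<open>The space of sigma-finite integer-valued measures\<close>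

definition counting_measures :: "'a measure \<Rightarrow> 'a measure set" where
  "counting_measures Y = {\<mu>. sets \<mu> = sets Y \<and> sigma_finite_measure \<mu> \<and>
     (\<forall>B\<in>sets Y. emeasure \<mu> B \<in> range of_nat \<union> {\<infinity>})}"

text \<open>The smallest sigma-field making all evaluations \<open>\<mu> \<mapsto> \<mu> B\<close> measurable, built like
  \<open>subprob_algebra\<close>.\<close>

definition counting_algebra :: "'a measure \<Rightarrow> 'a measure measure" where
  "counting_algebra Y =
     (SUP B \<in> sets Y. vimage_algebra (counting_measures Y) (\<lambda>\<mu>. emeasure \<mu> B) borel)"

lemma space_counting_algebra: "space (counting_algebra Y) = counting_measures Y"
  by (auto simp: counting_algebra_def space_Sup_eq_UN)

lemma measurable_emeasure_counting_algebra:
  "B \<in> sets Y \<Longrightarrow> (\<lambda>\<mu>. emeasure \<mu> B) \<in> borel_measurable (counting_algebra Y)"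
  by (auto intro!: measurable_Sup1 measurable_vimage_algebra1 simp: counting_algebra_def)

lemma measurable_counting_algebraI:
  assumes "\<And>x. x \<in> space M \<Longrightarrow> K x \<in> counting_measures Y"
    and "\<And>B. B \<in> sets Y \<Longrightarrow> (\<lambda>x. emeasure (K x) B) \<in> borel_measurable M"
  shows "K \<in> measurable M (counting_algebra Y)"
  using assms by (auto intro!: measurable_Sup2 measurable_vimage_algebra2 simp: counting_algebra_def)

subsection \<open>Poisson processes\<close>

text \<open>The Poisson distribution with parameter in \<open>[0, \<infinity>]\<close>; the degenerate parameters
  0 and \<open>\<infinity>\<close> (not covered by \<open>poisson_pmf\<close>) give the point masses at 0 and \<open>\<infinity>\<close>.\<close>

definition poisson_distribution :: "ennreal \<Rightarrow> ennreal measure" where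
  "poisson_distribution r =
     (if r = 0 then return borel 0
      else if r = \<infinity> then return borel \<infinity>
      else distr (measure_pmf (poisson_pmf (enn2real r))) borel of_nat)"

locale poisson_process = prob_space P + intensity: sigma_finite_measure L
  for P :: "'w measure" and L :: "'a measure" +
  fixes \<eta> :: "'w \<Rightarrow> 'a measure"
  assumes measurable_process: "\<eta> \<in> measurable P (counting_algebra L)"
    and distr_process: "\<And>B. B \<in> sets L \<Longrightarrow>
      distr P borel (\<lambda>\<omega>. emeasure (\<eta> \<omega>) B) = poisson_distribution (emeasure L B)"
    and indep_process: "\<And>k (B :: nat \<Rightarrow> 'a set). (\<And>i. i < k \<Longrightarrow> B i \<in> sets L) \<Longrightarrow>
      disjoint_family_on B {..<k} \<Longrightarrow>
      indep_vars (\<lambda>_. borel) (\<lambda>i \<omega>. emeasure (\<eta> \<omega>) (B i)) {..<k}"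

subsection \<open>Difference operators\<close>

definition add_measure :: "'a measure \<Rightarrow> 'a measure \<Rightarrow> 'a measure" where
  "add_measure \<mu> \<nu> = measure_of (space \<mu>) (sets \<mu>) (\<lambda>B. emeasure \<mu> B + emeasure \<nu> B)"

lemma space_add_measure [simp]: "space (add_measure \<mu> \<nu>) = space \<mu>"
  and sets_add_measure [simp]: "sets (add_measure \<mu> \<nu>) = sets \<mu>"
  by (simp_all add: add_measure_def)

lemma emeasure_add_measure:
  assumes "sets \<nu> = sets \<mu>" and "B \<in> sets \<mu>"
  shows "emeasure (add_measure \<mu> \<nu>) B = emeasure \<mu> B + emeasure \<nu> B"
proof (rule emeasure_measure_of[OF add_measure_def])
  show "countably_additive (sets (add_measure \<mu> \<nu>)) (\<lambda>B. emeasure \<mu> B + emeasure \<nu> B)"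
    using assms(1)
    by (auto intro!: countably_additiveI simp flip: suminf_add simp: suminf_emeasure image_subset_iff)
qed (use assms sets.space_closed in \<open>auto simp: positive_def\<close>)

text \<open>\<open>return \<mu> y\<close> is the Dirac measure at \<open>y\<close> on the measurable space underlying \<open>\<mu>\<close>.\<close>

definition diff_op :: "'a \<Rightarrow> ('a measure \<Rightarrow> real) \<Rightarrow> 'a measure \<Rightarrow> real" where
  "diff_op y f \<mu> = f (add_measure \<mu> (return \<mu> y)) - f \<mu>"

primrec diff_ops :: "'a list \<Rightarrow> ('a measure \<Rightarrow> real) \<Rightarrow> 'a measure \<Rightarrow> real" where
  "diff_ops [] f = f"
| "diff_ops (y # ys) f = diff_op y (diff_ops ys f)"

lemma add_dirac_in_counting_measures:
  assumes \<mu>: "\<mu> \<in> counting_measures Y"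
  shows "add_measure \<mu> (return \<mu> y) \<in> counting_measures Y"
proof -
  let ?\<nu> = "add_measure \<mu> (return \<mu> y)"
  have s: "sets \<mu> = sets Y" and sf: "sigma_finite_measure \<mu>"
    and v: "\<And>B. B \<in> sets Y \<Longrightarrow> emeasure \<mu> B \<in> range of_nat \<union> {\<infinity>}"
    using \<mu> by (auto simp: counting_measures_def)
  have e: "emeasure ?\<nu> B = emeasure \<mu> B + indicator B y" if "B \<in> sets Y" for B
    using that s by (simp add: emeasure_add_measure)
  obtain A :: "nat \<Rightarrow> 'a set" where A: "range A \<subseteq> sets \<mu>" "(\<Union>i. A i) = space \<mu>"
      "\<And>i. emeasure \<mu> (A i) \<noteq> \<infinity>"
    using sigma_finite_measure.sigma_finite[OF sf] by metis
  have "sigma_finite_measure ?\<nu>"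
  proof
    have "emeasure ?\<nu> (A i) \<noteq> \<infinity>" for i
      using A s e[of "A i"] by (auto simp: image_subset_iff split: split_indicator)
    then show "\<exists>A. countable A \<and> A \<subseteq> sets ?\<nu> \<and> \<Union> A = space ?\<nu> \<and> (\<forall>a\<in>A. emeasure ?\<nu> a \<noteq> \<infinity>)"
      using A by (intro exI[of _ "range A"]) auto
  qed
  moreover have "emeasure ?\<nu> B \<in> range of_nat \<union> {\<infinity>}" if B: "B \<in> sets Y" for B
  proof (cases "emeasure \<mu> B = \<infinity>")
    case False
    then obtain k :: nat where "emeasure \<mu> B = of_nat k"
      using v[OF B] by auto
    then have "emeasure ?\<nu> B = of_nat (if y \<in> B then Suc k else k)"
      by (simp add: e[OF B] add.commute)
    then show ?thesis by blast
  qed (simp add: e[OF B])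
  ultimately show ?thesis
    by (simp add: counting_measures_def s)
qed

text \<open>The \<open>n\<close>-fold product measure lives on functions on \<open>{..<n}\<close>, so that the argument
  \<open>(y\<^sub>1, \<dots>, y\<^sub>n)\<close> is \<open>(y 0, \<dots>, y (n - 1))\<close>. Where the expectation does not exist, the value
  of \<open>diff_mean\<close> is the default 0 of the Bochner integral.\<close>

definition product_power :: "'a measure \<Rightarrow> nat \<Rightarrow> (nat \<Rightarrow> 'a) measure" where
  "product_power L n = PiM {..<n} (\<lambda>_. L)"

definition diff_mean ::
    "'w measure \<Rightarrow> ('w \<Rightarrow> 'a measure) \<Rightarrow> nat \<Rightarrow> ('a measure \<Rightarrow> real) \<Rightarrow> (nat \<Rightarrow> 'a) \<Rightarrow> real" where
  "diff_mean P \<eta> n f y = (\<integral>\<omega>. diff_ops (map y [0..<n]) f (\<eta> \<omega>) \<partial>P)"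

subsection \<open>Square-integrable functions\<close>

definition L2_space :: "'b measure \<Rightarrow> ('b \<Rightarrow> real) set" where
  "L2_space M = {f \<in> borel_measurable M. integrable M (\<lambda>x. (f x)\<^sup>2)}"

definition L2_inner :: "'b measure \<Rightarrow> ('b \<Rightarrow> real) \<Rightarrow> ('b \<Rightarrow> real) \<Rightarrow> real" where
  "L2_inner M f g = (\<integral>x. f x * g x \<partial>M)"

definition L2_norm :: "'b measure \<Rightarrow> ('b \<Rightarrow> real) \<Rightarrow> real" where
  "L2_norm M f = sqrt (L2_inner M f f)"

end

theory Submission
  imports Defs
begin

text \<open>For exponential functionals \<open>f(\<mu>) = exp(-\<mu>(v))\<close> one has
  \<open>D\<^sub>y f = (exp(-v(y)) - 1) f\<close>, so \<open>T\<^sub>n f\<close> is \<open>\<E> f(\<eta>)\<close> times a tensor power and the identity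
  is the exponential series combined with the formula for the Laplace functional. It extends
  to the linear span of these functionals, which is dense in \<open>L\<^sup>2\<close> by a monotone class argument.
  The Mecke equation gives \<open>\<integral>\<^bsub>B\<^sup>n\<^esub> \<E>|D\<^sup>n f(\<eta>)| \<le> \<E> |f(\<eta>)| (\<eta>(B) + \<lambda>(B))\<^sup>n\<close> whenever
  \<open>\<lambda>(B) < \<infinity>\<close>; hence \<open>T\<^sub>n f\<^sub>k \<rightarrow> T\<^sub>n f\<close> almost everywhere if \<open>f\<^sub>k \<rightarrow> f\<close> fast enough in \<open>L\<^sup>2\<close>, and Fatou's
  lemma yields \<open>\<Sum>\<^sub>n \<parallel>T\<^sub>n f\<parallel>\<^sup>2 / n! \<le> \<E> f(\<eta>)\<^sup>2\<close>. The defect of this inequality is a nonnegative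
  quadratic form that vanishes on a dense subspace and is dominated by \<open>\<E> f(\<eta>)\<^sup>2\<close>, so it is zero.
  The bilinear identity follows by polarization.\<close>

subsection \<open>Exponential functionals\<close>

text \<open>The base space carries no structure, so a configuration need not be a sum of Dirac
  measures and the process cannot be handled point by point. It is therefore tested only through
  counts: an exponential functional of a simple function involves finitely many counts of disjoint
  sets, where independence and the Poisson law apply directly. Counts may be infinite, and
  \<open>expneg\<close> gives them the value 0. The Mecke equation is found by differentiating the
  Laplace functional in the direction of an indicator and is then extended by the same monotone
  class argument that yields density. The obstacle in the limit is that \<open>T_n f\<close> is a
  pointwise formula, not the continuous extension of an isometry. Closeness in L2, which ignores
  null sets, says nothing about \<open>f\<close> at a configuration with added points until the
  Mecke equation shows that, on sets of finite intensity, adding points costs only a polynomial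
  weight in the counts. This gives convergence of \<open>T_n f_k\<close> almost everywhere, and the
  detour through a quadratic form is what makes that weak mode of convergence sufficient.\<close>

definition expneg :: "ennreal \<Rightarrow> real" where
  "expneg z = (if z = \<infinity> then 0 else exp (- enn2real z))"

lemma expneg_0 [simp]: "expneg 0 = 1"
  by (simp add: expneg_def)

lemma expneg_infinity [simp]: "expneg \<infinity> = 0" "expneg top = 0"
  by (simp_all add: expneg_def)

lemma expneg_ennreal: "0 \<le> r \<Longrightarrow> expneg (ennreal r) = exp (- r)"
  by (simp add: expneg_def)

lemma expneg_of_nat: "expneg (of_nat k) = exp (- real k)"
  by (simp add: expneg_def)

lemma expneg_nonneg [simp]: "0 \<le> expneg z"
  by (simp add: expneg_def)

lemma expneg_le_1 [simp]: "expneg z \<le> 1"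
  by (simp add: expneg_def)

lemma measurable_expneg [measurable]: "expneg \<in> borel_measurable borel"
  unfolding expneg_def by measurable

text \<open>The functional equation survives infinite arguments, because both sides then vanish.
  This is what allows exponential functionals to be split without first excluding infinite
  counts.\<close>

lemma expneg_add: "expneg (a + b) = expneg a * expneg b"
  by (cases a; cases b) (simp_all add: expneg_ennreal mult_exp_exp flip: ennreal_plus)

lemma expneg_sum: "expneg (\<Sum>i\<in>I. z i) = (\<Prod>i\<in>I. expneg (z i))"
  by (induction I rule: infinite_finite_induct) (simp_all add: expneg_add)

lemma expneg_of_nat_mult: "expneg (of_nat i * z) = expneg z ^ i"
  using expneg_sum[of "\<lambda>_. z" "{..<i}"] by simp

section \<open>Counting measures and the addition of a point\<close>

lemma counting_measuresD:
  assumes "\<mu> \<in> counting_measures L"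
  shows "sets \<mu> = sets L" "space \<mu> = space L" "sigma_finite_measure \<mu>"
    "B \<in> sets L \<Longrightarrow> emeasure \<mu> B = \<infinity> \<or> (\<exists>k::nat. emeasure \<mu> B = of_nat k)"
proof -
  show *: "sets \<mu> = sets L" and "sigma_finite_measure \<mu>"
    "B \<in> sets L \<Longrightarrow> emeasure \<mu> B = \<infinity> \<or> (\<exists>k::nat. emeasure \<mu> B = of_nat k)"
    using assms by (auto simp: counting_measures_def)
  show "space \<mu> = space L"
    using * by (rule sets_eq_imp_space_eq)
qed

lemma emeasure_add_dirac:
  assumes "\<mu> \<in> counting_measures L" "B \<in> sets L"
  shows "emeasure (add_measure \<mu> (return \<mu> y)) B = emeasure \<mu> B + indicator B y"
  using counting_measuresD[OF assms(1)] assms(2) by (simp add: emeasure_add_measure)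

lemma measurable_add_dirac [measurable]:
  "(\<lambda>(\<mu>, y). add_measure \<mu> (return \<mu> y)) \<in> measurable (counting_algebra L \<Otimes>\<^sub>M L) (counting_algebra L)"
proof (rule measurable_counting_algebraI)
  fix B assume [measurable]: "B \<in> sets L"
  note [measurable] = measurable_emeasure_counting_algebra
  have "(\<lambda>x. emeasure (fst x) B + indicator B (snd x)) \<in> borel_measurable (counting_algebra L \<Otimes>\<^sub>M L)"
    by measurable
  then show "(\<lambda>x. emeasure (case x of (\<mu>, y) \<Rightarrow> add_measure \<mu> (return \<mu> y)) B)
      \<in> borel_measurable (counting_algebra L \<Otimes>\<^sub>M L)"
    by (rule measurable_cong[THEN iffD1, rotated])
      (auto simp: space_pair_measure space_counting_algebra emeasure_add_dirac)
qed (auto simp: space_pair_measure space_counting_algebra add_dirac_in_counting_measures)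

text \<open>The point \<open>y\<close> may lie outside the space of \<open>L\<close>, so this is not
  merely a section of the joint statement. It lets measurability of differences hold for every list
  of points.\<close>

lemma measurable_add_dirac_left [measurable]:
  "(\<lambda>\<mu>. add_measure \<mu> (return \<mu> y)) \<in> measurable (counting_algebra L) (counting_algebra L)"
proof (rule measurable_counting_algebraI)
  fix B assume B: "B \<in> sets L"
  note [measurable] = measurable_emeasure_counting_algebra[OF B]
  have "(\<lambda>x. emeasure x B + indicator B y) \<in> borel_measurable (counting_algebra L)"
    by measurable
  then show "(\<lambda>\<mu>. emeasure (add_measure \<mu> (return \<mu> y)) B) \<in> borel_measurable (counting_algebra L)"
    by (rule measurable_cong[THEN iffD1, rotated])
      (auto simp: space_counting_algebra emeasure_add_dirac B)
qed (auto simp: space_counting_algebra add_dirac_in_counting_measures)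

text \<open>Finitely many values turn the integral against a configuration into a finite combination
  of counts of disjoint level sets. The finite measure of the support keeps the exponent of the
  Laplace functional finite.\<close>

definition test_functions :: "'a measure \<Rightarrow> ('a \<Rightarrow> real) set" where
  "test_functions L = {v. simple_function L v \<and> (\<forall>y. 0 \<le> v y) \<and> emeasure L {y\<in>space L. v y \<noteq> 0} < \<infinity>}"

definition laplace :: "('a \<Rightarrow> real) \<Rightarrow> 'a measure \<Rightarrow> real" where
  "laplace v \<mu> = expneg (\<integral>\<^sup>+y. ennreal (v y) \<partial>\<mu>)"

lemma laplace_bounds [simp]: "0 \<le> laplace v \<mu>" "laplace v \<mu> \<le> 1"
  by (simp_all add: laplace_def)

lemma laplace_0 [simp]: "laplace (\<lambda>_. 0) \<mu> = 1"
  by (simp add: laplace_def)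

lemma test_functionsD:
  assumes "v \<in> test_functions L"
  shows "simple_function L v" "0 \<le> v y" "v \<in> borel_measurable L" "finite (v ` space L)"
    "emeasure L {y\<in>space L. v y \<noteq> 0} < \<infinity>" "v -` {c} \<inter> space L \<in> sets L"
proof -
  show *: "simple_function L v" "0 \<le> v y" "emeasure L {y\<in>space L. v y \<noteq> 0} < \<infinity>"
    using assms by (auto simp: test_functions_def)
  show "v \<in> borel_measurable L" using * borel_measurable_simple_function by blast
  then show "v -` {c} \<inter> space L \<in> sets L" by measurable
  show "finite (v ` space L)" using * by (auto simp: simple_function_def)
qed

lemma test_functions_0: "(\<lambda>_. 0) \<in> test_functions L"
  by (simp add: test_functions_def)

lemma test_functions_add:
  assumes v: "v \<in> test_functions L" and w: "w \<in> test_functions L"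
  shows "(\<lambda>y. v y + w y) \<in> test_functions L"
proof -
  note [measurable] = test_functionsD(3)[OF v] test_functionsD(3)[OF w]
  have "emeasure L {y\<in>space L. v y + w y \<noteq> 0}
      \<le> emeasure L ({y\<in>space L. v y \<noteq> 0} \<union> {y\<in>space L. w y \<noteq> 0})"
    by (intro emeasure_mono) auto
  also have "\<dots> \<le> emeasure L {y\<in>space L. v y \<noteq> 0} + emeasure L {y\<in>space L. w y \<noteq> 0}"
    by (intro emeasure_subadditive) auto
  also have "\<dots> < \<infinity>"
    using test_functionsD(5)[OF v] test_functionsD(5)[OF w] by simp
  finally show ?thesis
    using v w by (auto simp: test_functions_def intro!: simple_function_add)
qed

lemma test_functions_indicator:
  assumes "B \<in> sets L" "emeasure L B < \<infinity>" "0 \<le> c"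
  shows "(\<lambda>y. c * indicator B y) \<in> test_functions L"
proof -
  have "emeasure L {y\<in>space L. c * indicator B y \<noteq> (0::real)} \<le> emeasure L B"
    using assms by (intro emeasure_mono) (auto split: split_indicator_asm)
  then show ?thesis
    using assms by (auto simp: test_functions_def intro!: simple_function_mult)
qed

lemma ennreal_simple_decomposition:
  assumes "v \<in> test_functions L" "y \<in> space L"
  shows "ennreal (v y) = (\<Sum>c\<in>v ` space L. ennreal c * indicator (v -` {c} \<inter> space L) y)"
proof -
  have "(\<Sum>c\<in>v ` space L. ennreal c * indicator (v -` {c} \<inter> space L) y)
      = (\<Sum>c\<in>v ` space L. if v y = c then ennreal c else 0)"
    using assms(2) by (intro sum.cong) (auto simp: indicator_def)
  also have "\<dots> = ennreal (v y)"
    using assms test_functionsD(4)[OF assms(1)] by simp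
  finally show ?thesis ..
qed

lemma nn_integral_test_function:
  assumes v: "v \<in> test_functions L" and \<mu>: "sets \<mu> = sets L"
  shows "(\<integral>\<^sup>+y. ennreal (v y) \<partial>\<mu>)
    = (\<Sum>c\<in>v ` space L. ennreal c * emeasure \<mu> (v -` {c} \<inter> space L))"
proof -
  have sp: "space \<mu> = space L" using \<mu> by (rule sets_eq_imp_space_eq)
  have m [measurable]: "v -` {c} \<inter> space L \<in> sets \<mu>" for c
    using test_functionsD(6)[OF v] by (simp add: \<mu>)
  have "(\<integral>\<^sup>+y. ennreal (v y) \<partial>\<mu>)
      = (\<integral>\<^sup>+y. (\<Sum>c\<in>v ` space L. ennreal c * indicator (v -` {c} \<inter> space L) y) \<partial>\<mu>)"
    by (intro nn_integral_cong) (simp add: sp ennreal_simple_decomposition[OF v])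
  also have "\<dots> = (\<Sum>c\<in>v ` space L. \<integral>\<^sup>+y. ennreal c * indicator (v -` {c} \<inter> space L) y \<partial>\<mu>)"
    by (intro nn_integral_sum) measurable
  also have "\<dots> = (\<Sum>c\<in>v ` space L. ennreal c * emeasure \<mu> (v -` {c} \<inter> space L))"
    by (intro sum.cong refl nn_integral_cmult_indicator m)
  finally show ?thesis .
qed

text \<open>The level sets are disjoint, so under a Poisson process the factors are independent. The
  level set of 0 may have infinite mass, but contributes the factor 1 because
  \<open>0 * \<infinity> = 0\<close>.\<close>

lemma laplace_eq_prod:
  assumes "v \<in> test_functions L" "sets \<mu> = sets L"
  shows "laplace v \<mu> = (\<Prod>c\<in>v ` space L. expneg (ennreal c * emeasure \<mu> (v -` {c} \<inter> space L)))"
  by (simp add: laplace_def nn_integral_test_function[OF assms] expneg_sum)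

lemma measurable_laplace [measurable]:
  assumes v: "v \<in> test_functions L"
  shows "laplace v \<in> borel_measurable (counting_algebra L)"
proof -
  note [measurable] = measurable_emeasure_counting_algebra[OF test_functionsD(6)[OF v]]
  have "(\<lambda>\<mu>. \<Prod>c\<in>v ` space L. expneg (ennreal c * emeasure \<mu> (v -` {c} \<inter> space L)))
      \<in> borel_measurable (counting_algebra L)"
    by measurable
  then show ?thesis
    by (rule measurable_cong[THEN iffD1, rotated])
      (auto simp: space_counting_algebra laplace_eq_prod[OF v] counting_measuresD(1))
qed

lemma laplace_add_dirac:
  assumes v: "v \<in> test_functions L" and \<mu>: "\<mu> \<in> counting_measures L" and y: "y \<in> space L"
  shows "laplace v (add_measure \<mu> (return \<mu> y)) = laplace v \<mu> * exp (- v y)"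
proof -
  let ?\<nu> = "add_measure \<mu> (return \<mu> y)"
  note s = counting_measuresD(1)[OF \<mu>]
  have "(\<integral>\<^sup>+z. ennreal (v z) \<partial>?\<nu>)
      = (\<integral>\<^sup>+z. ennreal (v z) \<partial>\<mu>) + ennreal (v y)"
    using test_functionsD(6)[OF v]
    by (subst (1 2) nn_integral_test_function[OF v])
      (simp_all add: s emeasure_add_dirac[OF \<mu>] distrib_left sum.distrib
        ennreal_simple_decomposition[OF v y])
  then show ?thesis
    by (simp add: laplace_def expneg_add expneg_ennreal test_functionsD(2)[OF v])
qed

lemma laplace_add:
  assumes v: "v \<in> test_functions L" and w: "w \<in> test_functions L" and \<mu>: "sets \<mu> = sets L"
  shows "laplace (\<lambda>y. v y + w y) \<mu> = laplace v \<mu> * laplace w \<mu>"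
proof -
  have [measurable]: "v \<in> borel_measurable \<mu>" "w \<in> borel_measurable \<mu>"
    using test_functionsD(3)[OF v] test_functionsD(3)[OF w] measurable_cong_sets[OF \<mu> refl] by auto
  show ?thesis
    unfolding laplace_def
    by (simp add: nn_integral_add expneg_add[symmetric] test_functionsD(2)[OF v] test_functionsD(2)[OF w])
qed

inductive_set laplace_span :: "'a measure \<Rightarrow> ('a measure \<Rightarrow> real) set" for L where
  laplace: "v \<in> test_functions L \<Longrightarrow> laplace v \<in> laplace_span L"
| add: "f \<in> laplace_span L \<Longrightarrow> g \<in> laplace_span L \<Longrightarrow> (\<lambda>\<mu>. f \<mu> + g \<mu>) \<in> laplace_span L"
| scale: "f \<in> laplace_span L \<Longrightarrow> (\<lambda>\<mu>. c * f \<mu>) \<in> laplace_span L"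

lemma laplace_span_const: "(\<lambda>_. c) \<in> laplace_span L"
  using laplace_span.scale[OF laplace_span.laplace[OF test_functions_0], of c L] by simp

lemma laplace_span_sum:
  assumes "\<And>i. i \<in> I \<Longrightarrow> F i \<in> laplace_span L"
  shows "(\<lambda>\<mu>. \<Sum>i\<in>I. F i \<mu>) \<in> laplace_span L"
  using assms
  by (induction I rule: infinite_finite_induct) (simp_all add: laplace_span_const laplace_span.add)

lemma laplace_span_measurable: "f \<in> laplace_span L \<Longrightarrow> f \<in> borel_measurable (counting_algebra L)"
  by (induction rule: laplace_span.induct) auto

lemma laplace_span_bounded: "f \<in> laplace_span L \<Longrightarrow> \<exists>C. \<forall>\<mu>. \<bar>f \<mu>\<bar> \<le> C"
proof (induction rule: laplace_span.induct)
  case (laplace v)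
  then show ?case by (intro exI[of _ 1]) simp
next
  case (add f g)
  then obtain C D where "\<And>\<mu>. \<bar>f \<mu>\<bar> \<le> C" "\<And>\<mu>. \<bar>g \<mu>\<bar> \<le> D" by blast
  then show ?case by (intro exI[of _ "C + D"]) (meson abs_triangle_ineq add_mono order_trans)
next
  case (scale f c)
  then obtain C where "\<And>\<mu>. \<bar>f \<mu>\<bar> \<le> C" by blast
  then show ?case by (intro exI[of _ "\<bar>c\<bar> * C"]) (simp add: abs_mult mult_left_mono)
qed

subsection \<open>A monotone class theorem\<close>

text \<open>Uniform approximation keeps the functions bounded, and it is this boundedness that makes
  the closure stable under products; mere L2 approximation would not be.\<close>

definition uniform_closure :: "'a measure \<Rightarrow> ('a measure \<Rightarrow> real) set" where
  "uniform_closure L = {f. \<forall>\<epsilon>>0. \<exists>g\<in>laplace_span L. \<forall>\<mu>\<in>counting_measures L. \<bar>f \<mu> - g \<mu>\<bar> \<le> \<epsilon>}"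

lemma uniform_closure_bounded:
  assumes "f \<in> uniform_closure L"
  shows "\<exists>C>0. \<forall>\<mu>\<in>counting_measures L. \<bar>f \<mu>\<bar> \<le> C"
proof -
  obtain g where g: "g \<in> laplace_span L" "\<forall>\<mu>\<in>counting_measures L. \<bar>f \<mu> - g \<mu>\<bar> \<le> 1"
    using assms by (auto simp: uniform_closure_def dest: spec[of _ 1])
  obtain C where "\<forall>\<mu>. \<bar>g \<mu>\<bar> \<le> C" using laplace_span_bounded[OF g(1)] by blast
  then have C: "\<bar>g \<mu>\<bar> \<le> \<bar>C\<bar>" for \<mu> by (meson abs_ge_self order_trans)
  have "\<bar>f \<mu>\<bar> \<le> \<bar>C\<bar> + 1" if "\<mu> \<in> counting_measures L" for \<mu>
    using g(2)[rule_format, OF that] C[of \<mu>] by linarith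
  then show ?thesis by (intro exI[of _ "\<bar>C\<bar> + 1"]) auto
qed

text \<open>Multiplying exponential functionals adds their exponents. Integrals of test functions
  add up for measures on the sigma-field of \<open>L\<close>, so the product is represented by an
  element of the span that agrees with it on counting measures.\<close>

lemma laplace_span_mult:
  assumes f: "f \<in> laplace_span L" and g: "g \<in> laplace_span L"
  shows "\<exists>h\<in>laplace_span L. \<forall>\<mu>\<in>counting_measures L. h \<mu> = f \<mu> * g \<mu>"
  using f
proof (induction rule: laplace_span.induct)
  case (laplace v)
  show ?case using g
  proof (induction rule: laplace_span.induct)
    case (laplace w)
    then show ?case
      using \<open>v \<in> test_functions L\<close>
      by (intro bexI[of _ "laplace (\<lambda>y. v y + w y)"])
        (auto simp: laplace_add[OF \<open>v \<in> test_functions L\<close>] counting_measuresD(1)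
          intro!: laplace_span.laplace test_functions_add)
  next
    case (add f' g')
    then obtain h1 h2 where "h1\<in>laplace_span L" "\<forall>\<mu>\<in>counting_measures L. h1 \<mu> = laplace v \<mu> * f' \<mu>"
       "h2\<in>laplace_span L" "\<forall>\<mu>\<in>counting_measures L. h2 \<mu> = laplace v \<mu> * g' \<mu>" by blast
    then show ?case
      by (intro bexI[of _ "\<lambda>\<mu>. h1 \<mu> + h2 \<mu>"]) (auto simp: distrib_left intro: laplace_span.add)
  next
    case (scale f' c)
    then obtain h1 where "h1\<in>laplace_span L" "\<forall>\<mu>\<in>counting_measures L. h1 \<mu> = laplace v \<mu> * f' \<mu>"
      by blast
    then show ?case
      by (intro bexI[of _ "\<lambda>\<mu>. c * h1 \<mu>"]) (auto intro: laplace_span.scale)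
  qed
next
  case (add f' g')
  then obtain h1 h2 where "h1\<in>laplace_span L" "\<forall>\<mu>\<in>counting_measures L. h1 \<mu> = f' \<mu> * g \<mu>"
     "h2\<in>laplace_span L" "\<forall>\<mu>\<in>counting_measures L. h2 \<mu> = g' \<mu> * g \<mu>" by blast
  then show ?case
    by (intro bexI[of _ "\<lambda>\<mu>. h1 \<mu> + h2 \<mu>"]) (auto simp: distrib_right intro: laplace_span.add)
next
  case (scale f' c)
  then obtain h1 where "h1\<in>laplace_span L" "\<forall>\<mu>\<in>counting_measures L. h1 \<mu> = f' \<mu> * g \<mu>"
    by blast
  then show ?case
    by (intro bexI[of _ "\<lambda>\<mu>. c * h1 \<mu>"]) (auto intro: laplace_span.scale)
qed

lemma uniform_closure_mult:
  assumes f: "f \<in> uniform_closure L" and g: "g \<in> uniform_closure L"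
  shows "(\<lambda>\<mu>. f \<mu> * g \<mu>) \<in> uniform_closure L"
  unfolding uniform_closure_def mem_Collect_eq
proof (intro allI impI)
  fix \<epsilon> :: real assume \<epsilon>: "0 < \<epsilon>"
  obtain C where C: "C > 0" "\<forall>\<mu>\<in>counting_measures L. \<bar>g \<mu>\<bar> \<le> C"
    using uniform_closure_bounded[OF g] by blast
  obtain f' where f': "f' \<in> laplace_span L" "\<forall>\<mu>\<in>counting_measures L. \<bar>f \<mu> - f' \<mu>\<bar> \<le> \<epsilon> / (2 * C)"
    using f \<epsilon> C by (auto simp: uniform_closure_def dest!: spec[of _ "\<epsilon> / (2 * C)"])
  obtain D where D: "\<forall>\<mu>. \<bar>f' \<mu>\<bar> \<le> D" using laplace_span_bounded[OF f'(1)] by blast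
  \<comment> \<open>The tolerance for \<open>g\<close> depends on a bound for the chosen
    \<open>f'\<close>, so \<open>f'\<close> has to be fixed first. Adding 1 makes the bound
    positive, so that it can be divided by.\<close>
  define D' where "D' = \<bar>D\<bar> + 1"
  have D': "D' > 0" "\<And>\<mu>. \<bar>f' \<mu>\<bar> \<le> D'" using D unfolding D'_def by (auto intro: order_trans[OF D[rule_format]])
  obtain g' where g': "g' \<in> laplace_span L" "\<forall>\<mu>\<in>counting_measures L. \<bar>g \<mu> - g' \<mu>\<bar> \<le> \<epsilon> / (2 * D')"
    using g \<epsilon> D' by (auto simp: uniform_closure_def dest!: spec[of _ "\<epsilon> / (2 * D')"])
  obtain h where h: "h\<in>laplace_span L" "\<forall>\<mu>\<in>counting_measures L. h \<mu> = f' \<mu> * g' \<mu>"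
    using laplace_span_mult[OF f'(1) g'(1)] by blast
  have "\<bar>f \<mu> * g \<mu> - h \<mu>\<bar> \<le> \<epsilon>" if \<mu>: "\<mu> \<in> counting_measures L" for \<mu>
  proof -
    have "f \<mu> * g \<mu> - h \<mu> = (f \<mu> - f' \<mu>) * g \<mu> + f' \<mu> * (g \<mu> - g' \<mu>)"
      using h \<mu> by (simp add: algebra_simps)
    also have "\<bar>\<dots>\<bar> \<le> \<bar>f \<mu> - f' \<mu>\<bar> * \<bar>g \<mu>\<bar> + \<bar>f' \<mu>\<bar> * \<bar>g \<mu> - g' \<mu>\<bar>"
      by (metis abs_mult abs_triangle_ineq)
    also have "\<dots> \<le> \<epsilon> / (2 * C) * C + D' * (\<epsilon> / (2 * D'))"
      using f' g' C D' \<mu> by (intro add_mono mult_mono) (auto simp: less_imp_le)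
    also have "\<dots> = \<epsilon>" using C D' by simp
    finally show ?thesis .
  qed
  then show "\<exists>g'\<in>laplace_span L. \<forall>\<mu>\<in>counting_measures L. \<bar>f \<mu> * g \<mu> - g' \<mu>\<bar> \<le> \<epsilon>"
    using h(1) by blast
qed

text \<open>The values \<open>exp(-k)\<close> are isolated, so the indicator is a continuous function of
  \<open>exp(-\<mu>(B))\<close>, and polynomials in \<open>exp(-\<mu>(B))\<close> are exponential functionals.\<close>

lemma uniform_closure_indicator_eq:
  assumes B: "B \<in> sets L" "emeasure L B < \<infinity>"
  shows "indicator {\<mu> \<in> counting_measures L. emeasure \<mu> B = of_nat k} \<in> uniform_closure L"
  unfolding uniform_closure_def mem_Collect_eq
proof (intro allI impI)
  fix \<epsilon> :: real assume \<epsilon>: "0 < \<epsilon>"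
  \<comment> \<open>A tent of height 1 at \<open>exp (- k)\<close> with half-width
    \<open>exp (- (k + 1))\<close>. No other possible value of \<open>expneg\<close> at a count
    comes closer: the nearest one is \<open>exp (- (k + 1))\<close>, at distance at least the
    half-width because \<open>exp 1 \<ge> 2\<close>, and the value 0 of an infinite count lies
    farther away.\<close>
  define \<phi> where "\<phi> x = max 0 (1 - exp (real k + 1) * \<bar>x - exp (- real k)\<bar>)" for x :: real
  have "continuous_on {0..1} \<phi>"
    unfolding \<phi>_def by (intro continuous_intros)
  then obtain p where "real_polynomial_function p" and p: "\<And>x. x \<in> {0..1} \<Longrightarrow> \<bar>\<phi> x - p x\<bar> < \<epsilon>"
    using Stone_Weierstrass_real_polynomial_function[of "{0..1}" \<phi> \<epsilon>] \<epsilon> by auto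
  then obtain a n where pa: "p = (\<lambda>x. \<Sum>i\<le>n. a i * x ^ i)"
    by (auto simp: real_polynomial_function_iff_sum)
  have \<phi>_0: "\<phi> 0 = 0"
  proof -
    have "exp (real k + 1) * exp (- real k) \<ge> 1" by (simp flip: exp_add)
    then show ?thesis by (simp add: \<phi>_def)
  qed
  have sep: "\<phi> (exp (- real j)) = 0" if "j \<noteq> k" for j :: nat
  proof -
    have e: "2 \<le> exp (1::real)" using exp_ge_add_one_self[of 1] by simp
    have "1 \<le> exp (real k + 1) * \<bar>exp (- real j) - exp (- real k)\<bar>"
    proof (cases "j < k")
      case True
      have "2 * exp (- real k) \<le> exp 1 * exp (- real k)"
        using e by (intro mult_right_mono) auto
      also have "\<dots> \<le> exp (- real j)" using True by (simp flip: exp_add)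
      finally have "exp (- real k) \<le> \<bar>exp (- real j) - exp (- real k)\<bar>" by linarith
      then have "exp (real k + 1) * exp (- real k) \<le> exp (real k + 1) * \<bar>exp (- real j) - exp (- real k)\<bar>"
        by (intro mult_left_mono) auto
      moreover have "1 \<le> exp (real k + 1) * exp (- real k)" by (simp flip: exp_add)
      ultimately show ?thesis by linarith
    next
      case False
      with that have "k < j" by simp
      then have "exp (- real j) \<le> exp (- (real k + 1))" by simp
      moreover have "2 * exp (- (real k + 1)) \<le> exp 1 * exp (- (real k + 1))"
        using e by (intro mult_right_mono) auto
      moreover have "exp 1 * exp (- (real k + 1)) = exp (- real k)" by (simp flip: exp_add)
      ultimately have "exp (- (real k + 1)) \<le> \<bar>exp (- real j) - exp (- real k)\<bar>"
        by linarith
      then have "exp (real k + 1) * exp (- (real k + 1)) \<le> exp (real k + 1) * \<bar>exp (- real j) - exp (- real k)\<bar>"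
        by (intro mult_left_mono) auto
      then show ?thesis by (simp flip: exp_add)
    qed
    then show ?thesis by (simp add: \<phi>_def)
  qed
  have \<phi>: "\<phi> (expneg (emeasure \<mu> B)) = indicator {\<mu> \<in> counting_measures L. emeasure \<mu> B = of_nat k} \<mu>"
    if \<mu>: "\<mu> \<in> counting_measures L" for \<mu>
    using counting_measuresD(4)[OF \<mu> B(1)]
  proof
    assume "emeasure \<mu> B = \<infinity>" then show ?thesis by (simp add: \<phi>_0)
  next
    assume "\<exists>j::nat. emeasure \<mu> B = of_nat j"
    then obtain j :: nat where j: "emeasure \<mu> B = of_nat j" ..
    show ?thesis
    proof (cases "j = k")
      case True then show ?thesis using \<mu> j by (simp add: expneg_of_nat) (simp add: \<phi>_def)
    next
      case False
      then show ?thesis using \<mu> j sep[of j] by (simp add: expneg_of_nat)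
    qed
  qed
  define g where "g = (\<lambda>\<mu>. \<Sum>i\<le>n. a i * laplace (\<lambda>y. real i * indicator B y) \<mu>)"
  have g: "g \<in> laplace_span L"
    unfolding g_def
    by (intro laplace_span_sum laplace_span.scale laplace_span.laplace test_functions_indicator B) auto
  have "g \<mu> = p (expneg (emeasure \<mu> B))" if \<mu>: "\<mu> \<in> counting_measures L" for \<mu>
  proof -
    have "laplace (\<lambda>y. real i * indicator B y) \<mu> = expneg (emeasure \<mu> B) ^ i" for i
    proof -
      have "(\<integral>\<^sup>+y. ennreal (real i * indicator B y) \<partial>\<mu>) = (\<integral>\<^sup>+y. of_nat i * indicator B y \<partial>\<mu>)"
        by (intro nn_integral_cong) (auto simp: indicator_def ennreal_of_nat_eq_real_of_nat)
      also have "\<dots> = of_nat i * emeasure \<mu> B"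
        using B(1) counting_measuresD(1)[OF \<mu>] by (simp add: nn_integral_cmult_indicator)
      finally show ?thesis by (simp add: laplace_def expneg_of_nat_mult)
    qed
    then show ?thesis by (simp add: g_def pa)
  qed
  then have "\<bar>indicator {\<mu> \<in> counting_measures L. emeasure \<mu> B = of_nat k} \<mu> - g \<mu>\<bar> \<le> \<epsilon>"
    if \<mu>: "\<mu> \<in> counting_measures L" for \<mu>
    using p[of "expneg (emeasure \<mu> B)"] \<phi>[OF \<mu>] \<mu> by simp
  then show "\<exists>g\<in>laplace_span L. \<forall>\<mu>\<in>counting_measures L.
      \<bar>indicator {\<mu> \<in> counting_measures L. emeasure \<mu> B = of_nat k} \<mu> - g \<mu>\<bar> \<le> \<epsilon>"
    using g by blast
qed

section \<open>A generating pi-system of approximable events\<close>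

definition approximable_events :: "'a measure \<Rightarrow> 'a measure set set" where
  "approximable_events L = {A \<in> sets (counting_algebra L). indicator A \<in> uniform_closure L}"

lemma Int_stable_approximable_events: "Int_stable (approximable_events L)"
proof (rule Int_stableI)
  fix A B assume "A \<in> approximable_events L" "B \<in> approximable_events L"
  then have "A \<inter> B \<in> sets (counting_algebra L)"
    "(\<lambda>\<mu>. indicator A \<mu> * indicator B \<mu>) \<in> uniform_closure L"
    by (auto simp: approximable_events_def intro: uniform_closure_mult)
  moreover have "(\<lambda>\<mu>. indicator A \<mu> * indicator B \<mu> :: real) = indicator (A \<inter> B)"
    by (auto simp: indicator_def)
  ultimately show "A \<inter> B \<in> approximable_events L"
    by (simp add: approximable_events_def)
qed

text \<open>The approximable events include all \<open>\<mu>(B) = k\<close> with \<open>B\<close> of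
  finite intensity. These determine the counts of such sets, and sigma-finiteness recovers all other
  counts as monotone limits.\<close>

lemma sets_counting_algebra_eq_sigma_sets:
  assumes "sigma_finite_measure L"
  shows "sets (counting_algebra L) = sigma_sets (counting_measures L) (approximable_events L)"
proof
  let ?E = "approximable_events L" and ?N = "counting_measures L"
  let ?S = "sigma ?N ?E"
  have E: "?E \<subseteq> Pow ?N"
    using sets.sets_into_space by (force simp: approximable_events_def simp flip: space_counting_algebra)
  show "sigma_sets ?N ?E \<subseteq> sets (counting_algebra L)"
    using sets.sigma_sets_subset[of ?E "counting_algebra L"]
    by (auto simp: approximable_events_def space_counting_algebra)
  have fin: "(\<lambda>\<mu>. emeasure \<mu> B) \<in> borel_measurable ?S" if B: "B \<in> sets L" "emeasure L B < \<infinity>" for B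
  proof (rule measurableI)
    fix X :: "ennreal set" assume "X \<in> sets borel"
    note [measurable] = measurable_emeasure_counting_algebra[OF B(1)]
    define G where "G k = {\<mu> \<in> ?N. emeasure \<mu> B = of_nat k}" for k :: nat
    have "{\<mu> \<in> space (counting_algebra L). emeasure \<mu> B = of_nat k} \<in> sets (counting_algebra L)" for k :: nat
      by measurable
    then have "G k \<in> ?E" for k
      using uniform_closure_indicator_eq[OF B, of k]
      by (simp add: approximable_events_def G_def space_counting_algebra)
    then have G: "G k \<in> sets ?S" for k using E by auto
    \<comment> \<open>The value infinity is reached through complements: a count is infinite exactly
      when it equals no natural number, which is a countable condition.\<close>
    have "(\<lambda>\<mu>. emeasure \<mu> B) -` X \<inter> space ?S
        = (\<Union>k\<in>{k. of_nat k \<in> X}. G k) \<union> (if \<infinity> \<in> X then ?N - (\<Union>k. G k) else {})"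
      (is "_ = ?R")
    proof (rule set_eqI)
      fix \<mu>
      show "\<mu> \<in> (\<lambda>\<mu>. emeasure \<mu> B) -` X \<inter> space ?S \<longleftrightarrow> \<mu> \<in> ?R"
      proof (cases "\<mu> \<in> ?N")
        case True
        from counting_measuresD(4)[OF this B(1)] show ?thesis
          using True by (elim disjE exE) (simp_all add: G_def space_measure_of_conv ennreal_of_nat_neq_top)
      qed (auto simp: G_def space_measure_of_conv)
    qed
    also have "\<dots> \<in> sets ?S"
    proof -
      have "?N \<in> sets ?S" by (metis sets.top space_measure_of_conv)
      moreover have "(\<Union>k\<in>K. G k) \<in> sets ?S" for K
        by (intro sets.countable_UN'') (auto intro: G)
      ultimately show ?thesis by (auto intro!: sets.Un sets.Diff)
    qed
    finally show "(\<lambda>\<mu>. emeasure \<mu> B) -` X \<inter> space ?S \<in> sets ?S" .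
  qed auto
  obtain S :: "nat \<Rightarrow> 'a set" where S: "range S \<subseteq> sets L" "(\<Union>i. S i) = space L"
      "\<And>i. emeasure L (S i) \<noteq> \<infinity>" "incseq S"
    using sigma_finite_measure.sigma_finite_incseq[OF assms] by metis
  have "(\<lambda>\<mu>. \<mu>) \<in> measurable ?S (counting_algebra L)"
  proof (rule measurable_counting_algebraI)
    fix B assume B: "B \<in> sets L"
    \<comment> \<open>A set of infinite intensity is cut by an exhausting sequence of sets of finite
      intensity; its count is the supremum of the counts of the pieces.\<close>
    have "(\<lambda>\<mu>. SUP i. emeasure \<mu> (B \<inter> S i)) \<in> borel_measurable ?S"
    proof (intro borel_measurable_SUP fin)
      fix i show "B \<inter> S i \<in> sets L" using B S(1) by auto
      have "emeasure L (B \<inter> S i) \<le> emeasure L (S i)"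
        using S(1) by (intro emeasure_mono) auto
      also have "\<dots> < \<infinity>" using S(3)[of i] by (simp add: top.not_eq_extremum)
      finally show "emeasure L (B \<inter> S i) < \<infinity>" .
    qed auto
    then show "(\<lambda>\<mu>. emeasure \<mu> B) \<in> borel_measurable ?S"
    proof (rule measurable_cong[THEN iffD1, rotated])
      fix \<mu> assume "\<mu> \<in> space ?S"
      then have \<mu>: "\<mu> \<in> ?N" by (simp add: space_measure_of_conv)
      have "(SUP i. emeasure \<mu> (B \<inter> S i)) = emeasure \<mu> (\<Union>i. B \<inter> S i)"
        using S(1,4) B counting_measuresD(1)[OF \<mu>]
        by (intro SUP_emeasure_incseq) (auto simp: incseq_def)
      also have "(\<Union>i. B \<inter> S i) = B"
        using S(2) sets.sets_into_space[OF B] by auto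
      finally show "(SUP i. emeasure \<mu> (B \<inter> S i)) = emeasure \<mu> B" .
    qed
  qed (simp add: space_measure_of_conv)
  then have "A \<in> sets ?S" if "A \<in> sets (counting_algebra L)" for A
    using measurable_sets[of "\<lambda>\<mu>. \<mu>" ?S "counting_algebra L" A] that sets.sets_into_space[OF that]
    by (simp add: space_measure_of_conv space_counting_algebra Int_absorb2)
  then show "sets (counting_algebra L) \<subseteq> sigma_sets ?N ?E"
    using E by auto
qed

text \<open>The monotone class theorem in the shape of an induction rule. It serves twice: for the
  Mecke equation, where \<open>Q\<close> is equality of two integrals, and for density, where
  \<open>Q\<close> is L2 approximability. Both are stable under bounded pointwise limits by
  dominated convergence.\<close>

lemma laplace_span_induct_indicator [consumes 2, case_names span add scale lim]:
  assumes "sigma_finite_measure L" "A \<in> sets (counting_algebra L)"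
    and span: "\<And>f. f \<in> laplace_span L \<Longrightarrow> Q f"
    and add: "\<And>f g. Q f \<Longrightarrow> Q g \<Longrightarrow> Q (\<lambda>\<mu>. f \<mu> + g \<mu>)"
    and scale: "\<And>f c. Q f \<Longrightarrow> Q (\<lambda>\<mu>. c * f \<mu>)"
    and lim: "\<And>F f C. (\<And>i::nat. Q (F i)) \<Longrightarrow>
      (\<And>i \<mu>. \<mu> \<in> counting_measures L \<Longrightarrow> \<bar>F i \<mu>\<bar> \<le> C) \<Longrightarrow>
      (\<And>\<mu>. \<mu> \<in> counting_measures L \<Longrightarrow> (\<lambda>i. F i \<mu>) \<longlonglongrightarrow> f \<mu>) \<Longrightarrow> Q f"
  shows "Q (indicator A :: 'a measure \<Rightarrow> real)"
proof -
  let ?E = "approximable_events L" and ?N = "counting_measures L"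
  have E: "?E \<subseteq> Pow ?N"
    using sets.sets_into_space by (force simp: approximable_events_def simp flip: space_counting_algebra)
  have unif: "Q f" if f: "f \<in> uniform_closure L" for f
  proof -
    obtain C where C: "\<forall>\<mu>\<in>?N. \<bar>f \<mu>\<bar> \<le> C" using uniform_closure_bounded[OF f] by blast
    have "\<forall>i::nat. \<exists>g\<in>laplace_span L. \<forall>\<mu>\<in>?N. \<bar>f \<mu> - g \<mu>\<bar> \<le> 1 / Suc i"
      using f by (auto simp: uniform_closure_def)
    then obtain F where F: "\<And>i. F i \<in> laplace_span L" "\<And>i \<mu>. \<mu> \<in> ?N \<Longrightarrow> \<bar>f \<mu> - F i \<mu>\<bar> \<le> 1 / Suc i"
      by metis
    show ?thesis
    proof (rule lim[of F])
      show "Q (F i)" for i by (intro span F)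
      show "\<bar>F i \<mu>\<bar> \<le> C + 1" if "\<mu> \<in> ?N" for i \<mu>
      proof -
        have "1 / real (Suc i) \<le> 1" by simp
        then show ?thesis using C[rule_format, OF that] F(2)[OF that, of i] by linarith
      qed
      show "(\<lambda>i. F i \<mu>) \<longlonglongrightarrow> f \<mu>" if "\<mu> \<in> ?N" for \<mu>
        using F(2)[OF that]
        by (intro Lim_transform_bound[OF _ LIMSEQ_inverse_real_of_nat, THEN LIM_zero_cancel])
          (auto simp: abs_minus_commute inverse_eq_divide)
    qed
  qed
  \<comment> \<open>The premise \<open>lim\<close> only looks at counting measures, so a constant
    sequence shows that \<open>Q\<close> ignores the values of a function elsewhere.\<close>
  have cong: "Q g" if "Q f" "\<And>\<mu>. \<mu> \<in> ?N \<Longrightarrow> f \<mu> = g \<mu>" "\<And>\<mu>. \<bar>f \<mu>\<bar> \<le> C" for f g C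
    by (rule lim[of "\<lambda>_. f" C g]) (use that(1,3) in simp_all, simp add: that(2))
  have one: "Q (\<lambda>_. 1)" by (intro span laplace_span_const)
  have zero: "Q (\<lambda>_. 0)" by (intro span laplace_span_const)
  have "A \<in> sigma_sets ?N ?E"
    using assms by (simp add: sets_counting_algebra_eq_sigma_sets)
  with Int_stable_approximable_events E show ?thesis
  proof (induction rule: sigma_sets_induct_disjoint)
    case (basic A)
    then show ?case by (intro unif) (simp add: approximable_events_def)
  next
    case empty
    then show ?case using zero by (simp add: indicator_def[abs_def])
  next
    case (compl A)
    \<comment> \<open>The complement is taken within the counting measures, so its indicator equals
      this function only there; \<open>cong\<close> repairs the difference.\<close>
    have "Q (\<lambda>\<mu>. 1 + (-1) * indicator A \<mu>)" by (intro add one scale compl)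
    then show ?case
      by (rule cong[where C = 1]) (auto simp: indicator_def)
  next
    case (union A)
    have sumQ: "Q (\<lambda>\<mu>. \<Sum>i<n. indicator (A i) \<mu>)" for n
      by (induction n) (auto intro!: add union zero)
    \<comment> \<open>Disjointness makes the partial sums indicators again, which supplies the
      uniform bound 1 that \<open>lim\<close> demands.\<close>
    have eq: "(\<Sum>i<n. indicator (A i) \<mu> :: real) = indicator (\<Union>i<n. A i) \<mu>" for n \<mu>
      using union by (intro indicator_UN_disjoint[symmetric]) (auto simp: disjoint_family_on_def)
    show ?case
    proof (rule lim[of "\<lambda>n \<mu>. \<Sum>i<n. indicator (A i) \<mu>"])
      show "\<bar>\<Sum>i<n. indicator (A i) \<mu>\<bar> \<le> (1::real)" for n \<mu>
        unfolding eq by (simp add: indicator_def)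
      show "(\<lambda>n. \<Sum>i<n. indicator (A i) \<mu>) \<longlonglongrightarrow> (indicator (\<Union>i. A i) \<mu> :: real)" for \<mu>
        unfolding eq by (rule LIMSEQ_indicator_UN)
    qed (rule sumQ)
  qed
qed

subsection \<open>Integrals against the Poisson distribution\<close>

text \<open>This is the generating function of the Poisson law at \<open>exp (- c)\<close>. The rate
  0 is treated apart, since there the distribution is defined as a point mass.\<close>

lemma integral_expneg_poisson:
  assumes "z < \<infinity>" "0 \<le> c"
  shows "(\<integral>x. expneg (ennreal c * x) \<partial>poisson_distribution z) = exp (- enn2real z * (1 - exp (- c)))"
proof (cases "z = 0")
  case True
  then show ?thesis by (simp add: poisson_distribution_def integral_return)
next
  case False
  define r where "r = enn2real z"
  have r: "0 < r" using False assms by (auto simp: r_def enn2real_positive_iff zero_less_iff_neq_zero)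
  have e: "expneg (ennreal c * of_nat k) = exp (- c) ^ k" for k
    using assms(2) by (simp add: ennreal_of_nat_eq_real_of_nat ennreal_mult[symmetric] expneg_ennreal
        exp_of_nat_mult[symmetric] mult.commute)
  have "(\<lambda>k. (r * exp (-c)) ^ k /\<^sub>R fact k) sums exp (r * exp (-c))"
    by (rule exp_converges)
  then have "(\<lambda>k. (r * exp (-c)) ^ k /\<^sub>R fact k * exp (- r)) sums (exp (r * exp (-c)) * exp (- r))"
    by (rule sums_mult2)
  then have s: "(\<lambda>k. pmf (poisson_pmf r) k * exp (- c) ^ k) sums exp (- r * (1 - exp (- c)))"
    using r by (simp add: pmf_poisson power_mult_distrib divide_inverse mult_ac algebra_simps flip: exp_add)
  have "(\<integral>x. expneg (ennreal c * x) \<partial>poisson_distribution z)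
      = (\<integral>k. exp (- c) ^ k \<partial>measure_pmf (poisson_pmf r))"
    using False assms less_imp_neq[OF assms(1)] by (simp add: poisson_distribution_def r_def[symmetric] integral_distr e)
  also have "\<dots> = (\<integral>k. pmf (poisson_pmf r) k * exp (- c) ^ k \<partial>count_space UNIV)"
    by (subst measure_pmf_eq_density) (simp add: integral_density)
  also have "\<dots> = exp (- r * (1 - exp (- c)))"
  proof -
    have "integrable (count_space UNIV) (\<lambda>k. pmf (poisson_pmf r) k * exp (- c) ^ k)"
      using s by (simp add: integrable_count_space_nat_iff abs_mult sums_iff)
    from sums_integral_count_space_nat[OF this] s show ?thesis by (simp add: sums_iff)
  qed
  finally show ?thesis by (simp add: r_def)
qed

lemma nn_integral_poisson:
  assumes "z < \<infinity>"
  shows "(\<integral>\<^sup>+x. x \<partial>poisson_distribution z) = z"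
proof (cases "z = 0")
  case True
  then show ?thesis by (simp add: poisson_distribution_def nn_integral_return)
next
  case False
  define r where "r = enn2real z"
  have r: "0 < r" using False assms by (auto simp: r_def enn2real_positive_iff zero_less_iff_neq_zero)
  \<comment> \<open>The recursion \<open>(k + 1) p (k + 1) = r * p k\<close> turns the series for
    the mean into \<open>r\<close> times the total mass; the term for \<open>k = 0\<close> vanishes,
    which permits the index shift.\<close>
  have "pmf (poisson_pmf r) (Suc k) * real (Suc k) = r * pmf (poisson_pmf r) k" for k
    using r by (simp add: field_simps del: of_nat_Suc)
  moreover have "(\<lambda>k. r * pmf (poisson_pmf r) k) sums (r * (exp r * exp (- r)))"
    using r sums_mult2[OF exp_converges[of r], of "exp (- r)"]
    by (intro sums_mult) (simp add: divide_inverse mult_ac)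
  ultimately have "(\<lambda>k. pmf (poisson_pmf r) (Suc k) * real (Suc k)) sums r"
    by (simp flip: exp_add)
  then have s: "(\<lambda>k. pmf (poisson_pmf r) k * real k) sums r"
    by (subst (asm) sums_Suc_iff) simp
  have "(\<integral>\<^sup>+x. x \<partial>poisson_distribution z) = (\<integral>\<^sup>+k. of_nat k \<partial>measure_pmf (poisson_pmf r))"
    using False assms less_imp_neq[OF assms(1)]
    by (simp add: poisson_distribution_def r_def[symmetric] nn_integral_distr)
  also have "\<dots> = (\<integral>\<^sup>+k. ennreal (pmf (poisson_pmf r) k * real k) \<partial>count_space UNIV)"
    by (subst measure_pmf_eq_density)
      (simp add: nn_integral_density ennreal_mult ennreal_of_nat_eq_real_of_nat del: pmf_poisson)
  also have "\<dots> = ennreal r"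
    using s by (subst nn_integral_count_space_nat) (simp add: suminf_ennreal2 sums_iff del: pmf_poisson)
  also have "\<dots> = z" using assms by (simp add: r_def)
  finally show ?thesis .
qed

text \<open>On level sets of nonzero values the measure is finite. The zero level set may be
  infinite, but there the coefficient \<open>1 - exp (- c)\<close> is 0, so that the value 0 of
  \<open>measure\<close> on an infinite set does no harm.\<close>

lemma
  assumes v: "v \<in> test_functions L"
  shows integrable_test_function: "integrable L (\<lambda>y. 1 - exp (- v y))"
    and integral_test_function:
      "(\<integral>y. 1 - exp (- v y) \<partial>L)
        = (\<Sum>c\<in>v ` space L. (1 - exp (- c)) * measure L (v -` {c} \<inter> space L))"
proof -
  let ?B = "\<lambda>c. v -` {c} \<inter> space L"
  have eq: "1 - exp (- v y) = (\<Sum>c\<in>v ` space L. (1 - exp (- c)) * indicator (?B c) y)"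
    if "y \<in> space L" for y
  proof -
    have "(\<Sum>c\<in>v ` space L. (1 - exp (- c)) * indicator (?B c) y)
        = (\<Sum>c\<in>v ` space L. if v y = c then 1 - exp (- c) else 0)"
      using that by (intro sum.cong) (auto simp: indicator_def)
    then show ?thesis
      using that test_functionsD(4)[OF v] by simp
  qed
  have B: "?B c \<in> sets L" for c using test_functionsD(6)[OF v] .
  have fin: "emeasure L (?B c) < \<infinity>" if "c \<noteq> 0" for c
  proof -
    note [measurable] = test_functionsD(3)[OF v]
    have "emeasure L (?B c) \<le> emeasure L {y\<in>space L. v y \<noteq> 0}"
      using that by (intro emeasure_mono) auto
    with test_functionsD(5)[OF v] show ?thesis by simp
  qed
  have int: "integrable L (\<lambda>y. (1 - exp (- c)) * indicator (?B c) y)" for c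
    by (cases "c = 0") (use B[of c] fin[of c] in auto)
  show "integrable L (\<lambda>y. 1 - exp (- v y))"
    by (subst Bochner_Integration.integrable_cong[OF refl eq]) (auto intro!: int)
  have "(\<integral>y. 1 - exp (- v y) \<partial>L) = (\<integral>y. (\<Sum>c\<in>v ` space L. (1 - exp (- c)) * indicator (?B c) y) \<partial>L)"
    by (intro Bochner_Integration.integral_cong eq refl)
  also have "\<dots> = (\<Sum>c\<in>v ` space L. \<integral>y. (1 - exp (- c)) * indicator (?B c) y \<partial>L)"
    by (intro Bochner_Integration.integral_sum int)
  also have "\<dots> = (\<Sum>c\<in>v ` space L. (1 - exp (- c)) * measure L (?B c))"
    by (intro sum.cong) (auto simp: Int_absorb2)
  finally show "(\<integral>y. 1 - exp (- v y) \<partial>L) = (\<Sum>c\<in>v ` space L. (1 - exp (- c)) * measure L (?B c))" .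
qed

text \<open>Differentiation along \<open>h = 1 / (n + 1)\<close>. It is applied both to the Laplace
  functional and to its integrand, so that the two limits run along the same sequence and can be
  identified.\<close>

lemma difference_quotient_LIMSEQ:
  assumes "(F has_real_derivative D) (at 0)"
  shows "(\<lambda>n. real (Suc n) * (F (1 / real (Suc n)) - F 0)) \<longlonglongrightarrow> D"
proof -
  have "((\<lambda>h. (F h - F 0) / h) \<longlongrightarrow> D) (at 0)"
    using assms by (simp add: has_field_derivative_iff)
  moreover have "filterlim (\<lambda>n. 1 / real (Suc n)) (at 0) sequentially"
    using LIMSEQ_inverse_real_of_nat by (auto simp: filterlim_at inverse_eq_divide)
  ultimately have "(\<lambda>n. (F (1 / real (Suc n)) - F 0) / (1 / real (Suc n))) \<longlonglongrightarrow> D"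
    by (rule filterlim_compose)
  then show ?thesis by (simp add: mult.commute)
qed

subsection \<open>Difference operators and square-integrable functions\<close>

lemma measurable_diff_op:
  assumes [measurable]: "f \<in> borel_measurable (counting_algebra L)"
  shows "diff_op z f \<in> borel_measurable (counting_algebra L)"
  unfolding diff_op_def[abs_def] by measurable

text \<open>An arbitrary list of indices replaces \<open>[0..<n]\<close> so that the head can be
  split off. The outer difference composes the inner one with the map that keeps \<open>y\<close>
  and adds a point to the measure, whence joint measurability is carried along.\<close>

lemma measurable_diff_ops_pair:
  assumes f [measurable]: "f \<in> borel_measurable (counting_algebra L)" and "set is \<subseteq> I"
  shows "(\<lambda>(y, \<mu>). diff_ops (map y is) f \<mu>)
    \<in> borel_measurable (PiM I (\<lambda>_. L) \<Otimes>\<^sub>M counting_algebra L)"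
  using assms(2)
proof (induction "is")
  case Nil
  then show ?case by simp
next
  case (Cons i "is")
  let ?F = "\<lambda>(y, \<mu>). diff_ops (map y is) f \<mu>"
  have F [measurable]: "?F \<in> borel_measurable (PiM I (\<lambda>_. L) \<Otimes>\<^sub>M counting_algebra L)"
    using Cons by simp
  have [measurable]: "(\<lambda>y. y i) \<in> measurable (PiM I (\<lambda>_. L)) L"
    using Cons.prems by (intro measurable_component_singleton) auto
  have "(\<lambda>x. (snd x, fst x i)) \<in> measurable (PiM I (\<lambda>_. L) \<Otimes>\<^sub>M counting_algebra L) (counting_algebra L \<Otimes>\<^sub>M L)"
    by measurable
  from measurable_compose[OF this measurable_add_dirac]
  have [measurable]: "(\<lambda>x. add_measure (snd x) (return (snd x) (fst x i)))
      \<in> measurable (PiM I (\<lambda>_. L) \<Otimes>\<^sub>M counting_algebra L) (counting_algebra L)"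
    by simp
  have "(\<lambda>x. (fst x, add_measure (snd x) (return (snd x) (fst x i))))
      \<in> measurable (PiM I (\<lambda>_. L) \<Otimes>\<^sub>M counting_algebra L) (PiM I (\<lambda>_. L) \<Otimes>\<^sub>M counting_algebra L)"
    by measurable
  from measurable_compose[OF this F]
  have "(\<lambda>x. ?F (fst x, add_measure (snd x) (return (snd x) (fst x i))) - ?F x)
      \<in> borel_measurable (PiM I (\<lambda>_. L) \<Otimes>\<^sub>M counting_algebra L)"
    using F by (rule borel_measurable_diff)
  then show ?case
    by (simp add: diff_op_def split_def)
qed

lemma measurable_diff_ops:
  assumes f: "f \<in> borel_measurable (counting_algebra L)"
  shows "diff_ops ys f \<in> borel_measurable (counting_algebra L)"
  by (induction ys) (simp_all add: f measurable_diff_op)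

lemma diff_ops_append: "diff_ops (xs @ ys) f = diff_ops xs (diff_ops ys f)"
  by (induction xs) simp_all

text \<open>The larger factor squared already dominates the product, also for infinite values.
  Together with a free scaling factor this takes the place of the Cauchy-Schwarz inequality in
  \<open>diff_ops_L2_bound\<close>.\<close>

lemma ennreal_mult_le_squares: "a * b \<le> a * a + b * (b :: ennreal)"
proof (cases "a \<le> b")
  case True
  then have "a * b \<le> b * b" by (intro mult_right_mono) auto
  then show ?thesis by (simp add: add_increasing)
next
  case False
  then have "a * b \<le> a * a" by (intro mult_left_mono) auto
  then show ?thesis by (simp add: add_increasing2)
qed

lemma diff_ops_add:
  "diff_ops ys (\<lambda>\<mu>. f \<mu> + g \<mu>) \<mu> = diff_ops ys f \<mu> + diff_ops ys g \<mu>"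
  by (induction ys arbitrary: \<mu>) (simp_all add: diff_op_def)

lemma diff_ops_scale: "diff_ops ys (\<lambda>\<mu>. c * f \<mu>) \<mu> = c * diff_ops ys f \<mu>"
  by (induction ys arbitrary: \<mu>) (simp_all add: diff_op_def right_diff_distrib)

lemma diff_ops_diff:
  "diff_ops ys (\<lambda>\<mu>. f \<mu> - g \<mu>) \<mu> = diff_ops ys f \<mu> - diff_ops ys g \<mu>"
  by (induction ys arbitrary: \<mu>) (simp_all add: diff_op_def)

lemma diff_ops_bounded:
  assumes "\<And>\<mu>. \<bar>f \<mu>\<bar> \<le> C"
  shows "\<bar>diff_ops ys f \<mu>\<bar> \<le> 2 ^ length ys * C"
proof (induction ys arbitrary: \<mu>)
  case Nil
  then show ?case using assms by simp
next
  case (Cons y ys)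
  have "\<bar>diff_ops (y # ys) f \<mu>\<bar>
      \<le> \<bar>diff_ops ys f (add_measure \<mu> (return \<mu> y))\<bar> + \<bar>diff_ops ys f \<mu>\<bar>"
    by (simp add: diff_op_def)
  also have "\<dots> \<le> 2 ^ length ys * C + 2 ^ length ys * C"
    by (intro add_mono Cons.IH)
  finally show ?case by (simp add: mult_ac)
qed

lemma diff_ops_laplace:
  assumes v: "v \<in> test_functions L" and \<mu>: "\<mu> \<in> counting_measures L" and "set ys \<subseteq> space L"
  shows "diff_ops ys (laplace v) \<mu> = (\<Prod>y\<leftarrow>ys. exp (- v y) - 1) * laplace v \<mu>"
  using assms(2,3)
  by (induction ys arbitrary: \<mu>)
    (simp_all add: diff_op_def laplace_add_dirac[OF v] add_dirac_in_counting_measures algebra_simps)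

section \<open>Calculus of square-integrable functions\<close>

lemma square_add_le: "((a::real) + b)\<^sup>2 \<le> 2 * a\<^sup>2 + 2 * b\<^sup>2"
  using sum_squares_ge_zero[of "a - b" 0] by (simp add: power2_eq_square algebra_simps)

lemma L2_integrable_square: "f \<in> L2_space M \<Longrightarrow> integrable M (\<lambda>x. (f x)\<^sup>2)"
  by (simp add: L2_space_def)

lemma L2_measurable: "f \<in> L2_space M \<Longrightarrow> f \<in> borel_measurable M"
  by (simp add: L2_space_def)

lemma L2_integrable_mult:
  assumes f: "f \<in> L2_space M" and g: "g \<in> L2_space M"
  shows "integrable M (\<lambda>x. f x * g x)"
proof (rule Bochner_Integration.integrable_bound)
  show "integrable M (\<lambda>x. (f x)\<^sup>2 + (g x)\<^sup>2)"
    using f g by (simp add: L2_space_def)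
  show "(\<lambda>x. f x * g x) \<in> borel_measurable M"
    by (intro borel_measurable_times L2_measurable f g)
  have "\<bar>a * b\<bar> \<le> a\<^sup>2 + b\<^sup>2" for a b :: real
  proof -
    have "2 * (\<bar>a\<bar> * \<bar>b\<bar>) \<le> a\<^sup>2 + b\<^sup>2"
      using sum_squares_bound[of "\<bar>a\<bar>" "\<bar>b\<bar>"] by (simp add: mult.assoc)
    moreover have "0 \<le> \<bar>a\<bar> * \<bar>b\<bar>" by simp
    ultimately show ?thesis unfolding abs_mult by linarith
  qed
  then show "AE x in M. norm (f x * g x) \<le> norm ((f x)\<^sup>2 + (g x)\<^sup>2)" by simp
qed

lemma L2_add:
  assumes f: "f \<in> L2_space M" and g: "g \<in> L2_space M"
  shows "(\<lambda>x. f x + g x) \<in> L2_space M"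
proof -
  have "(\<lambda>x. f x + g x) \<in> borel_measurable M"
    by (intro borel_measurable_add L2_measurable f g)
  moreover have "integrable M (\<lambda>x. (f x)\<^sup>2 + (g x)\<^sup>2 + 2 * (f x * g x))"
    using L2_integrable_square[OF f] L2_integrable_square[OF g] L2_integrable_mult[OF f g] by simp
  ultimately show ?thesis by (simp add: L2_space_def power2_sum mult.assoc)
qed

lemma L2_scale: "f \<in> L2_space M \<Longrightarrow> (\<lambda>x. c * f x) \<in> L2_space M"
  by (auto simp: L2_space_def power_mult_distrib)

lemma L2_diff:
  assumes f: "f \<in> L2_space M" and g: "g \<in> L2_space M"
  shows "(\<lambda>x. f x - g x) \<in> L2_space M"
  using L2_add[OF f L2_scale[OF g, of "-1"]] by simp

lemma (in finite_measure) L2_bounded: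
  assumes "f \<in> borel_measurable M" "AE x in M. \<bar>f x\<bar> \<le> C"
  shows "f \<in> L2_space M"
proof -
  have "AE x in M. norm ((f x)\<^sup>2) \<le> C\<^sup>2"
    using assms(2) by eventually_elim (simp add: abs_le_square_iff[symmetric])
  then show ?thesis
    using assms(1) by (auto simp: L2_space_def intro!: integrable_const_bound)
qed

lemma integral_square_add_le:
  assumes f: "f \<in> L2_space M" and g: "g \<in> L2_space M"
  shows "(\<integral>x. (f x + g x)\<^sup>2 \<partial>M) \<le> 2 * (\<integral>x. (f x)\<^sup>2 \<partial>M) + 2 * (\<integral>x. (g x)\<^sup>2 \<partial>M)"
proof -
  have "(\<integral>x. (f x + g x)\<^sup>2 \<partial>M) \<le> (\<integral>x. 2 * (f x)\<^sup>2 + 2 * (g x)\<^sup>2 \<partial>M)"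
    using L2_integrable_square[OF L2_add[OF f g]] L2_integrable_square[OF f] L2_integrable_square[OF g]
    by (intro integral_mono square_add_le) auto
  then show ?thesis
    using L2_integrable_square[OF f] L2_integrable_square[OF g] by simp
qed

text \<open>The difference of the two sides is a square divided by \<open>e\<close>. A small
  \<open>e\<close> keeps the factor of \<open>a\<^sup>2\<close> near 1, which is what gives the
  constant 1 in \<open>suminf_fock_energy_le\<close>.\<close>

lemma square_add_le_weighted:
  fixes a b e :: real
  assumes "0 < e"
  shows "(a + b)\<^sup>2 \<le> (1 + e) * a\<^sup>2 + (1 + 1 / e) * b\<^sup>2"
proof -
  have "(1 + e) * a\<^sup>2 + (1 + 1 / e) * b\<^sup>2 - (a + b)\<^sup>2 = (e * a - b)\<^sup>2 / e"
    using assms by (simp add: field_simps power2_eq_square)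
  also have "\<dots> \<ge> 0" using assms by simp
  finally show ?thesis by simp
qed

subsection \<open>Laplace functional and Mecke equation\<close>

context poisson_process
begin

abbreviation law :: "'a measure measure" where
  "law \<equiv> distr P (counting_algebra L) \<eta>"

interpretation law: prob_space law
  by (intro prob_space_distr measurable_process)

lemma sigma_finite_L: "sigma_finite_measure L"
  by (rule intensity.sigma_finite_measure_axioms)

interpretation LL: product_sigma_finite "\<lambda>_ :: nat. L"
  by (simp add: product_sigma_finite_def sigma_finite_L)

lemma measurable_law_eq [simp]:
  "measurable law = measurable (counting_algebra L)"
  by (intro ext measurable_cong_sets) auto

text \<open>Numbering the values of \<open>v\<close> turns the level sets into a finite disjoint
  family as in \<open>indep_process\<close>. Independence factors the expectation, and each factor
  is a Poisson generating function.\<close>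

lemma expectation_laplace:
  assumes v: "v \<in> test_functions L"
  shows "(\<integral>\<mu>. laplace v \<mu> \<partial>law) = exp (- (\<integral>y. 1 - exp (- v y) \<partial>L))"
proof -
  obtain c k where c: "bij_betw c {..<k::nat} (v ` space L)"
    using ex_bij_betw_nat_finite[OF test_functionsD(4)[OF v]] by (auto simp: atLeast0LessThan)
  define B where "B i = v -` {c i} \<inter> space L" for i
  define X where "X i \<omega> = expneg (ennreal (c i) * emeasure (\<eta> \<omega>) (B i))" for i \<omega>
  have B: "B i \<in> sets L" for i using test_functionsD(6)[OF v] by (simp add: B_def)
  have c0: "0 \<le> c i" if "i < k" for i
    using bij_betwE[OF c] that test_functionsD(2)[OF v] by (metis imageE lessThan_iff)
  have disj: "disjoint_family_on B {..<k}"
    using c by (auto simp: disjoint_family_on_def B_def bij_betw_def inj_on_def)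
  note ind = indep_process[of k B, OF B disj]
  have ind': "indep_vars (\<lambda>_. borel) X {..<k}"
    unfolding X_def[abs_def] using ind by (rule indep_vars_compose2) measurable
  have mB: "(\<lambda>\<omega>. emeasure (\<eta> \<omega>) (B i)) \<in> borel_measurable P" for i
    using measurable_compose[OF measurable_process measurable_emeasure_counting_algebra[OF B[of i]]] .
  have "(\<integral>\<mu>. laplace v \<mu> \<partial>law) = (\<integral>\<omega>. laplace v (\<eta> \<omega>) \<partial>P)"
    by (intro integral_distr measurable_process measurable_laplace v)
  also have "\<dots> = (\<integral>\<omega>. (\<Prod>i<k. X i \<omega>) \<partial>P)"
  proof (intro Bochner_Integration.integral_cong refl)
    fix \<omega> assume "\<omega> \<in> space P"
    then have "\<eta> \<omega> \<in> counting_measures L"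
      using measurable_space[OF measurable_process] by (simp add: space_counting_algebra)
    then have "sets (\<eta> \<omega>) = sets L" by (rule counting_measuresD)
    then show "laplace v (\<eta> \<omega>) = (\<Prod>i<k. X i \<omega>)"
      unfolding laplace_eq_prod[OF v \<open>sets (\<eta> \<omega>) = sets L\<close>] X_def B_def
      by (intro prod.reindex_bij_betw[OF c, symmetric])
  qed
  also have "\<dots> = (\<Prod>i<k. \<integral>\<omega>. X i \<omega> \<partial>P)"
  proof (intro indep_vars_lebesgue_integral ind')
    fix i
    have "X i \<in> borel_measurable P"
      unfolding X_def[abs_def] using mB[of i] by measurable
    then show "integrable P (X i)"
      by (intro integrable_const_bound[where B = 1]) (auto simp: X_def)
  qed auto
  also have "\<dots> = (\<Prod>i<k. exp (- ((1 - exp (- c i)) * measure L (B i))))"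
  proof (intro prod.cong refl)
    fix i assume "i \<in> {..<k}"
    then have i: "i < k" by simp
    show "(\<integral>\<omega>. X i \<omega> \<partial>P) = exp (- ((1 - exp (- c i)) * measure L (B i)))"
    proof (cases "c i = 0")
      \<comment> \<open>The zero level set may have infinite intensity; its factor is 1 whatever the
        count is.\<close>
      case True
      then show ?thesis by (simp add: X_def prob_space)
    next
      case False
      note [measurable] = test_functionsD(3)[OF v]
      have "emeasure L (B i) \<le> emeasure L {y\<in>space L. v y \<noteq> 0}"
        using False by (intro emeasure_mono) (auto simp: B_def)
      then have fin: "emeasure L (B i) < \<infinity>"
        using test_functionsD(5)[OF v] by simp
      have "(\<integral>\<omega>. X i \<omega> \<partial>P)
          = (\<integral>x. expneg (ennreal (c i) * x) \<partial>distr P borel (\<lambda>\<omega>. emeasure (\<eta> \<omega>) (B i)))"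
        unfolding X_def using mB[of i] by (subst integral_distr) auto
      then show ?thesis
        using integral_expneg_poisson[OF fin c0[OF i]]
        by (simp add: distr_process[OF B] measure_def mult.commute)
    qed
  qed
  also have "\<dots> = exp (- (\<Sum>i<k. (1 - exp (- c i)) * measure L (B i)))"
    by (simp add: exp_sum sum_negf[symmetric])
  also have "(\<Sum>i<k. (1 - exp (- c i)) * measure L (B i)) = (\<integral>y. 1 - exp (- v y) \<partial>L)"
    unfolding integral_test_function[OF v] B_def by (rule sum.reindex_bij_betw[OF c])
  finally show ?thesis .
qed

section \<open>The Mecke equation\<close>

lemma nn_integral_emeasure_process:
  assumes B: "B \<in> sets L" "emeasure L B < \<infinity>"
  shows "(\<integral>\<^sup>+\<mu>. emeasure \<mu> B \<partial>law) = emeasure L B"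
proof -
  note mB = measurable_emeasure_counting_algebra[OF B(1)]
  have "(\<integral>\<^sup>+\<mu>. emeasure \<mu> B \<partial>law) = (\<integral>\<^sup>+\<omega>. emeasure (\<eta> \<omega>) B \<partial>P)"
    by (intro nn_integral_distr measurable_process) (simp add: mB)
  also have "\<dots> = (\<integral>\<^sup>+x. x \<partial>distr P borel (\<lambda>\<omega>. emeasure (\<eta> \<omega>) B))"
    using measurable_compose[OF measurable_process mB] by (subst nn_integral_distr) auto
  finally show ?thesis
    by (simp add: distr_process[OF B(1)] nn_integral_poisson[OF B(2)])
qed

text \<open>Adding a point at \<open>y\<close> multiplies \<open>laplace v\<close> by
  \<open>exp (- v y)\<close>, so the third claim is the Mecke equation for exponential functionals.
  The first two supply the dominating function and dispose of infinite counts.\<close>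

lemma integral_laplace_times_count:
  assumes v: "v \<in> test_functions L" and B: "B \<in> sets L" "emeasure L B < \<infinity>"
  shows "integrable law (\<lambda>\<mu>. measure \<mu> B)"
    and "AE \<mu> in law. emeasure \<mu> B = ennreal (measure \<mu> B)"
    and "(\<integral>\<mu>. laplace v \<mu> * measure \<mu> B \<partial>law)
      = (\<integral>\<mu>. laplace v \<mu> \<partial>law) * (\<integral>y. exp (- v y) * indicator B y \<partial>L)"
proof -
  note mB [measurable] = measurable_emeasure_counting_algebra[OF B(1)]
  note [measurable] = measurable_laplace[OF v]
  have mm [measurable]: "(\<lambda>\<mu>. measure \<mu> B) \<in> borel_measurable (counting_algebra L)"
    unfolding measure_def by measurable
  have fin: "(\<integral>\<^sup>+\<mu>. emeasure \<mu> B \<partial>law) < \<infinity>"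
    using nn_integral_emeasure_process[OF B] B by simp
  have "AE \<mu> in law. emeasure \<mu> B \<noteq> \<infinity>"
    using fin by (intro nn_integral_noteq_infinite) (simp_all add: mB)
  then show AE: "AE \<mu> in law. emeasure \<mu> B = ennreal (measure \<mu> B)"
    by eventually_elim (simp add: emeasure_eq_ennreal_measure)
  show int: "integrable law (\<lambda>\<mu>. measure \<mu> B)"
  proof (rule integrableI_nonneg)
    have "(\<integral>\<^sup>+\<mu>. ennreal (measure \<mu> B) \<partial>law) = (\<integral>\<^sup>+\<mu>. emeasure \<mu> B \<partial>law)"
      using AE by (intro nn_integral_cong_AE) auto
    then show "(\<integral>\<^sup>+\<mu>. ennreal (measure \<mu> B) \<partial>law) < \<infinity>" using fin by simp
  qed auto
  \<comment> \<open>The count \<open>\<mu>(B)\<close> is the limit of the difference quotients \<open>n (1 - exp(-\<mu>(B) / n))\<close>, so the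
    integral is a derivative of the Laplace functional.\<close>
  define t where "t n = 1 / real (Suc n)" for n
  have t0: "0 \<le> t n" for n by (simp add: t_def)
  define w where "w n = (\<lambda>y. t n * indicator B y :: real)" for n
  have w: "w n \<in> test_functions L" for n
    unfolding w_def t_def by (intro test_functions_indicator B) auto
  have vw: "(\<lambda>y. v y + w n y) \<in> test_functions L" for n
    by (intro test_functions_add v w)
  have lw: "laplace (w n) \<mu> = exp (- (t n * measure \<mu> B))"
    if "\<mu> \<in> counting_measures L" "emeasure \<mu> B = ennreal (measure \<mu> B)" for n \<mu>
  proof -
    have "(\<integral>\<^sup>+y. ennreal (w n y) \<partial>\<mu>) = (\<integral>\<^sup>+y. ennreal (t n) * indicator B y \<partial>\<mu>)"
      by (intro nn_integral_cong) (auto simp: w_def indicator_def)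
    also have "\<dots> = ennreal (t n) * emeasure \<mu> B"
      using B counting_measuresD(1)[OF that(1)] by (intro nn_integral_cmult_indicator) auto
    also have "\<dots> = ennreal (t n * measure \<mu> B)"
      by (subst that(2)) (simp add: ennreal_mult t0)
    finally show ?thesis by (simp add: laplace_def expneg_ennreal t0)
  qed
  define l where "l = (\<integral>\<mu>. laplace v \<mu> \<partial>law)"
  define a where "a = (\<integral>y. exp (- v y) * indicator B y \<partial>L)"
  have li: "integrable law (laplace u)" if "u \<in> test_functions L" for u
    using measurable_laplace[OF that] by (intro law.integrable_const_bound[where B = 1]) auto
  have inta: "integrable L (\<lambda>y. exp (- v y) * indicator B y)"
  proof (rule Bochner_Integration.integrable_bound)
    show "integrable L (indicator B :: 'a \<Rightarrow> real)" using B by simp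
    show "(\<lambda>y. exp (- v y) * indicator B y) \<in> borel_measurable L"
      using test_functionsD(3)[OF v] B by measurable
  qed (auto simp: indicator_def test_functionsD(2)[OF v])
  \<comment> \<open>The right-hand side is left as the difference quotient at 0 of
    \<open>F h = - l * exp (- ((1 - exp (- h)) * a))\<close>, whose derivative there is
    \<open>l * a\<close>.\<close>
  have E: "real (Suc n) * (l - (\<integral>\<mu>. laplace (\<lambda>y. v y + w n y) \<mu> \<partial>law))
      = real (Suc n) * (- l * exp (- ((1 - exp (- t n)) * a)) - - l * exp (- ((1 - exp (- 0)) * a)))" for n
  proof -
    have "(\<integral>y. 1 - exp (- (v y + w n y)) \<partial>L)
        = (\<integral>y. (1 - exp (- v y)) + (1 - exp (- t n)) * (exp (- v y) * indicator B y) \<partial>L)"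
      by (intro Bochner_Integration.integral_cong refl)
        (auto simp: w_def indicator_def algebra_simps simp flip: exp_add)
    also have "\<dots> = (\<integral>y. 1 - exp (- v y) \<partial>L) + (1 - exp (- t n)) * a"
      unfolding a_def using inta integrable_test_function[OF v] by simp
    finally have "exp (- (\<integral>y. 1 - exp (- (v y + w n y)) \<partial>L))
        = exp (- (\<integral>y. 1 - exp (- v y) \<partial>L)) * exp (- ((1 - exp (- t n)) * a))"
      by (simp add: mult_exp_exp)
    then show ?thesis
      unfolding l_def expectation_laplace[OF v] expectation_laplace[OF vw] by simp
  qed
  have lim1: "(\<lambda>n. real (Suc n) * (l - (\<integral>\<mu>. laplace (\<lambda>y. v y + w n y) \<mu> \<partial>law))) \<longlonglongrightarrow> l * a"
    unfolding E t_def
    by (rule difference_quotient_LIMSEQ) (auto intro!: derivative_eq_intros)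
  have "(\<lambda>n. \<integral>\<mu>. laplace v \<mu> * (real (Suc n) * (1 - laplace (w n) \<mu>)) \<partial>law)
      \<longlonglongrightarrow> (\<integral>\<mu>. laplace v \<mu> * measure \<mu> B \<partial>law)"
  proof (rule integral_dominated_convergence[OF _ _ int])
    show "(\<lambda>\<mu>. laplace v \<mu> * measure \<mu> B) \<in> borel_measurable law" by simp
    show "(\<lambda>\<mu>. laplace v \<mu> * (real (Suc n) * (1 - laplace (w n) \<mu>))) \<in> borel_measurable law" for n
      using measurable_laplace[OF w[of n]] by simp
    have "AE \<mu> in law. \<mu> \<in> counting_measures L"
      by (intro AE_I2) (simp add: space_counting_algebra)
    then show "AE \<mu> in law. (\<lambda>n. laplace v \<mu> * (real (Suc n) * (1 - laplace (w n) \<mu>)))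
        \<longlonglongrightarrow> laplace v \<mu> * measure \<mu> B"
      using AE
    proof eventually_elim
      case (elim \<mu>)
      have "(\<lambda>n. real (Suc n) * (- exp (- (t n * measure \<mu> B)) - - exp (- (0 * measure \<mu> B))))
          \<longlonglongrightarrow> measure \<mu> B"
        unfolding t_def by (rule difference_quotient_LIMSEQ) (auto intro!: derivative_eq_intros)
      then show ?case by (intro tendsto_mult tendsto_const) (simp add: lw elim)
    qed
    fix n
    show "AE \<mu> in law. norm (laplace v \<mu> * (real (Suc n) * (1 - laplace (w n) \<mu>))) \<le> measure \<mu> B"
      using \<open>AE \<mu> in law. \<mu> \<in> counting_measures L\<close> AE
    proof eventually_elim
      case (elim \<mu>)
      \<comment> \<open>The inequality \<open>1 - exp (- x) \<le> x\<close> bounds all difference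
        quotients by the count itself, which is integrable.\<close>
      have "1 - laplace (w n) \<mu> \<le> t n * measure \<mu> B"
        using exp_ge_add_one_self[of "- (t n * measure \<mu> B)"] by (simp add: lw elim)
      then have "real (Suc n) * (1 - laplace (w n) \<mu>) \<le> real (Suc n) * (t n * measure \<mu> B)"
        by (intro mult_left_mono) auto
      also have "\<dots> = measure \<mu> B" by (simp add: t_def)
      finally have "laplace v \<mu> * (real (Suc n) * (1 - laplace (w n) \<mu>)) \<le> 1 * measure \<mu> B"
        by (intro mult_mono) (auto intro!: mult_nonneg_nonneg)
      then show ?case by (simp add: abs_mult)
    qed
  qed
  also have "(\<lambda>n. \<integral>\<mu>. laplace v \<mu> * (real (Suc n) * (1 - laplace (w n) \<mu>)) \<partial>law)
      = (\<lambda>n. real (Suc n) * (l - (\<integral>\<mu>. laplace (\<lambda>y. v y + w n y) \<mu> \<partial>law)))"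
  proof
    fix n
    have "(\<integral>\<mu>. laplace v \<mu> * (real (Suc n) * (1 - laplace (w n) \<mu>)) \<partial>law)
        = (\<integral>\<mu>. real (Suc n) * (laplace v \<mu> - laplace (\<lambda>y. v y + w n y) \<mu>) \<partial>law)"
      by (intro Bochner_Integration.integral_cong refl)
        (auto simp: space_counting_algebra laplace_add[OF v w counting_measuresD(1)] algebra_simps)
    then show "(\<integral>\<mu>. laplace v \<mu> * (real (Suc n) * (1 - laplace (w n) \<mu>)) \<partial>law)
        = real (Suc n) * (l - (\<integral>\<mu>. laplace (\<lambda>y. v y + w n y) \<mu> \<partial>law))"
      by (simp add: l_def li[OF v] li[OF vw])
  qed
  finally show "(\<integral>\<mu>. laplace v \<mu> * measure \<mu> B \<partial>law) = l * a"
    using lim1 by (rule LIMSEQ_unique)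
qed

text \<open>For \<open>B\<close> of finite intensity both sides are finite measures, so bounded
  functions of either sign can serve as tests. Agreement on exponential functionals then spreads to
  all events by monotone class induction.\<close>

lemma mecke_distr:
  assumes B: "B \<in> sets L" "emeasure L B < \<infinity>"
  shows "distr (law \<Otimes>\<^sub>M density L (indicator B)) (counting_algebra L) (\<lambda>(\<mu>, y). add_measure \<mu> (return \<mu> y))
    = density law (\<lambda>\<mu>. emeasure \<mu> B)" (is "?M1 = ?M2")
proof -
  let ?R = "density L (indicator B)"
  let ?s = "\<lambda>(\<mu>, y). add_measure \<mu> (return \<mu> y)"
  note mB [measurable] = measurable_emeasure_counting_algebra[OF B(1)]
  have R: "finite_measure ?R"
    using B by (intro finite_measureI) (simp add: emeasure_density)
  then interpret R: finite_measure ?R .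
  interpret lR: pair_sigma_finite law ?R ..
  interpret lRf: finite_measure "law \<Otimes>\<^sub>M ?R"
    by (intro finite_measure_pair_measure law.finite_measure_axioms R)
  have s: "?s \<in> measurable (law \<Otimes>\<^sub>M ?R) (counting_algebra L)"
    using measurable_add_dirac[of L]
    by (subst measurable_cong_sets[OF sets_pair_measure_cong refl]) auto
  interpret M1: finite_measure ?M1
    by (intro lRf.finite_measure_distr s)
  interpret M2: finite_measure ?M2
  proof (rule finite_measureI)
    have "emeasure ?M2 (space ?M2)
        = (\<integral>\<^sup>+\<mu>. emeasure \<mu> B * indicator (space (counting_algebra L)) \<mu> \<partial>law)"
      by (simp add: emeasure_density mB)
    also have "\<dots> = (\<integral>\<^sup>+\<mu>. emeasure \<mu> B \<partial>law)"
      by (intro nn_integral_cong) simp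
    finally show "emeasure ?M2 (space ?M2) \<noteq> \<infinity>"
      using nn_integral_emeasure_process[OF B] B(2) by simp
  qed
  \<comment> \<open>Boundedness and measurability belong to the predicate because they give
    integrability with respect to both measures, without which equality of integrals would not be
    additive.\<close>
  define Q where "Q f \<longleftrightarrow> f \<in> borel_measurable (counting_algebra L) \<and>
      (\<exists>C. \<forall>\<mu>\<in>counting_measures L. \<bar>f \<mu>\<bar> \<le> C) \<and> (\<integral>\<mu>. f \<mu> \<partial>?M1) = (\<integral>\<mu>. f \<mu> \<partial>?M2)" for f :: "'a measure \<Rightarrow> real"
  have int: "integrable ?M1 f" "integrable ?M2 f" if Qf: "Q f" for f
  proof -
    obtain C where "\<forall>\<mu>\<in>counting_measures L. \<bar>f \<mu>\<bar> \<le> C" using Qf by (auto simp: Q_def)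
    then show "integrable ?M1 f" "integrable ?M2 f"
      using Qf by (auto intro!: M1.integrable_const_bound[where B = C] M2.integrable_const_bound[where B = C]
          AE_I2 simp: Q_def space_counting_algebra)
  qed
  have addQ: "Q (\<lambda>\<mu>. f \<mu> + g \<mu>)" if f: "Q f" and g: "Q g" for f g
  proof -
    obtain C D where "\<forall>\<mu>\<in>counting_measures L. \<bar>f \<mu>\<bar> \<le> C" "\<forall>\<mu>\<in>counting_measures L. \<bar>g \<mu>\<bar> \<le> D"
      using f g unfolding Q_def by blast
    then have "\<forall>\<mu>\<in>counting_measures L. \<bar>f \<mu> + g \<mu>\<bar> \<le> C + D"
      by (meson abs_triangle_ineq add_mono order_trans)
    then show ?thesis using f g int[OF f] int[OF g] by (auto simp: Q_def)
  qed
  have scaleQ: "Q (\<lambda>\<mu>. c * f \<mu>)" if f: "Q f" for f c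
  proof -
    obtain C where "\<forall>\<mu>\<in>counting_measures L. \<bar>f \<mu>\<bar> \<le> C"
      using f unfolding Q_def by blast
    then have "\<forall>\<mu>\<in>counting_measures L. \<bar>c * f \<mu>\<bar> \<le> \<bar>c\<bar> * C"
      by (simp add: abs_mult mult_left_mono)
    then show ?thesis using f int[OF f] by (auto simp: Q_def)
  qed
  have lapQ: "Q (laplace v)" if v: "v \<in> test_functions L" for v
  proof -
    note [measurable] = measurable_laplace[OF v]
    have a: "(\<integral>y. exp (- v y) \<partial>?R) = (\<integral>y. exp (- v y) * indicator B y \<partial>L)"
    proof -
      have "?R = density L (\<lambda>y. ennreal (indicator B y))" by (simp add: ennreal_indicator)
      then show ?thesis
        using B test_functionsD(3)[OF v] by (simp add: integral_real_density mult.commute)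
    qed
    have "(\<integral>\<mu>. laplace v \<mu> \<partial>?M1) = (\<integral>x. laplace v (?s x) \<partial>(law \<Otimes>\<^sub>M ?R))"
      by (intro integral_distr s measurable_laplace v)
    also have "\<dots> = (\<integral>\<mu>. \<integral>y. laplace v (?s (\<mu>, y)) \<partial>?R \<partial>law)"
    proof (rule lR.integral_fst'[symmetric])
      show "integrable (law \<Otimes>\<^sub>M ?R) (\<lambda>x. laplace v (?s x))"
        using measurable_compose[OF s measurable_laplace[OF v]]
        by (intro lRf.integrable_const_bound[where B = 1]) auto
    qed
    also have "\<dots> = (\<integral>\<mu>. laplace v \<mu> * (\<integral>y. exp (- v y) \<partial>?R) \<partial>law)"
    proof (intro Bochner_Integration.integral_cong refl)
      fix \<mu> assume "\<mu> \<in> space law"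
      then have \<mu>: "\<mu> \<in> counting_measures L" by (simp add: space_counting_algebra)
      have "(\<integral>y. laplace v (?s (\<mu>, y)) \<partial>?R) = (\<integral>y. laplace v \<mu> * exp (- v y) \<partial>?R)"
        by (intro Bochner_Integration.integral_cong refl) (simp add: laplace_add_dirac[OF v \<mu>])
      then show "(\<integral>y. laplace v (?s (\<mu>, y)) \<partial>?R) = laplace v \<mu> * (\<integral>y. exp (- v y) \<partial>?R)" by simp
    qed
    also have "\<dots> = (\<integral>\<mu>. laplace v \<mu> \<partial>law) * (\<integral>y. exp (- v y) * indicator B y \<partial>L)"
      by (simp add: a)
    also have "\<dots> = (\<integral>\<mu>. laplace v \<mu> * measure \<mu> B \<partial>law)"
      by (rule integral_laplace_times_count(3)[OF v B, symmetric])
    also have "\<dots> = (\<integral>\<mu>. laplace v \<mu> \<partial>?M2)"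
    proof -
      have [measurable]: "(\<lambda>\<mu>. measure \<mu> B) \<in> borel_measurable (counting_algebra L)"
        unfolding measure_def by measurable
      have "?M2 = density law (\<lambda>\<mu>. ennreal (measure \<mu> B))"
        using integral_laplace_times_count(2)[OF v B] by (intro density_cong) (simp_all add: mB)
      then show ?thesis by (simp add: integral_real_density mult.commute)
    qed
    finally show ?thesis by (auto simp: Q_def intro!: exI[of _ 1])
  qed
  show ?thesis
  proof (rule measure_eqI)
    fix A assume "A \<in> sets ?M1"
    then have A: "A \<in> sets (counting_algebra L)" by simp
    have "Q (indicator A)"
      using sigma_finite_L A
    proof (induction rule: laplace_span_induct_indicator)
      case (span f)
      then show ?case
        by (induction rule: laplace_span.induct) (blast intro: lapQ addQ scaleQ)+
    next
      case (lim F f C)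
      have F: "F i \<in> borel_measurable (counting_algebra L)"
        "(\<integral>\<mu>. F i \<mu> \<partial>?M1) = (\<integral>\<mu>. F i \<mu> \<partial>?M2)" for i
        using lim(1)[of i] by (simp_all add: Q_def)
      have m: "f \<in> borel_measurable (counting_algebra L)"
        by (rule borel_measurable_LIMSEQ_real[OF lim(3) F(1)]) (simp add: space_counting_algebra)
      have "\<bar>f \<mu>\<bar> \<le> C" if "\<mu> \<in> counting_measures L" for \<mu>
        by (rule LIMSEQ_le_const2[OF tendsto_rabs[OF lim(3)[OF that]]]) (use lim(2) that in auto)
      then have bd: "\<exists>C. \<forall>\<mu>\<in>counting_measures L. \<bar>f \<mu>\<bar> \<le> C" by blast
      have AEs: "AE \<mu> in K. (\<lambda>i. F i \<mu>) \<longlonglongrightarrow> f \<mu>" "AE \<mu> in K. \<bar>F i \<mu>\<bar> \<le> C"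
        if "space K = counting_measures L" for K i
        using lim(2,3) by (auto intro!: AE_I2 simp: that)
      have "(\<lambda>i. \<integral>\<mu>. F i \<mu> \<partial>?M1) \<longlonglongrightarrow> (\<integral>\<mu>. f \<mu> \<partial>?M1)"
        by (rule integral_dominated_convergence[where w = "\<lambda>_. C"])
          (simp_all add: m F(1) AEs space_counting_algebra)
      moreover have "(\<lambda>i. \<integral>\<mu>. F i \<mu> \<partial>?M2) \<longlonglongrightarrow> (\<integral>\<mu>. f \<mu> \<partial>?M2)"
        by (rule integral_dominated_convergence[where w = "\<lambda>_. C"])
          (simp_all add: m F(1) AEs space_counting_algebra)
      ultimately have "(\<integral>\<mu>. f \<mu> \<partial>?M1) = (\<integral>\<mu>. f \<mu> \<partial>?M2)"
        unfolding F(2) by (rule LIMSEQ_unique)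
      then show ?case using m bd by (simp add: Q_def)
    qed (blast intro: addQ scaleQ)+
    then show "emeasure ?M1 A = emeasure ?M2 A"
      using A sets.sets_into_space[OF A]
      by (simp add: Q_def M1.emeasure_eq_measure M2.emeasure_eq_measure Int_absorb2)
  qed simp
qed

lemma mecke:
  assumes B: "B \<in> sets L" "emeasure L B < \<infinity>"
    and H [measurable]: "H \<in> borel_measurable (counting_algebra L)"
  shows "(\<integral>\<^sup>+\<mu>. \<integral>\<^sup>+y. H (add_measure \<mu> (return \<mu> y)) * indicator B y \<partial>L \<partial>law)
    = (\<integral>\<^sup>+\<mu>. H \<mu> * emeasure \<mu> B \<partial>law)"
proof -
  let ?R = "density L (indicator B)"
  let ?s = "\<lambda>(\<mu>, y). add_measure \<mu> (return \<mu> y)"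
  note mB [measurable] = measurable_emeasure_counting_algebra[OF B(1)]
  interpret R: finite_measure ?R
    using B by (intro finite_measureI) (simp add: emeasure_density)
  have s: "?s \<in> measurable (law \<Otimes>\<^sub>M ?R) (counting_algebra L)"
    using measurable_add_dirac[of L]
    by (subst measurable_cong_sets[OF sets_pair_measure_cong refl]) auto
  have "(\<integral>\<^sup>+\<mu>. H \<mu> * emeasure \<mu> B \<partial>law) = (\<integral>\<^sup>+\<mu>. H \<mu> \<partial>density law (\<lambda>\<mu>. emeasure \<mu> B))"
    by (simp add: nn_integral_density mult.commute mB)
  also have "\<dots> = (\<integral>\<^sup>+x. H (?s x) \<partial>(law \<Otimes>\<^sub>M ?R))"
    unfolding mecke_distr[OF B, symmetric] by (intro nn_integral_distr s) (simp add: H)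
  also have "\<dots> = (\<integral>\<^sup>+\<mu>. \<integral>\<^sup>+y. H (?s (\<mu>, y)) \<partial>?R \<partial>law)"
    by (rule R.nn_integral_fst[symmetric]) (rule measurable_compose[OF s H])
  also have "\<dots> = (\<integral>\<^sup>+\<mu>. \<integral>\<^sup>+y. H (?s (\<mu>, y)) * indicator B y \<partial>L \<partial>law)"
  proof (intro nn_integral_cong)
    fix \<mu> assume "\<mu> \<in> space law"
    then have "(\<lambda>y. H (?s (\<mu>, y))) \<in> borel_measurable L"
      by (intro measurable_compose[OF _ H] measurable_compose[OF _ measurable_add_dirac]) simp
    then show "(\<integral>\<^sup>+y. H (?s (\<mu>, y)) \<partial>?R) = (\<integral>\<^sup>+y. H (?s (\<mu>, y)) * indicator B y \<partial>L)"
      using B by (simp add: nn_integral_density mult.commute)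
  qed
  finally show ?thesis by simp
qed

text \<open>The Mecke equation trades one factor \<open>\<mu>(B)\<close> for the constant
  \<open>\<lambda>(B)\<close> and one extra point in the remaining power. The free shift
  \<open>c\<close> absorbs that point, so the induction closes.\<close>

lemma moments_finite:
  assumes B: "B \<in> sets L" "emeasure L B < \<infinity>"
  shows "c < \<infinity> \<Longrightarrow> (\<integral>\<^sup>+\<mu>. (emeasure \<mu> B + c) ^ m \<partial>law) < \<infinity>"
proof (induction m arbitrary: c)
  case 0
  then show ?case using law.emeasure_space_1 by simp
next
  case (Suc m)
  note mB [measurable] = measurable_emeasure_counting_algebra[OF B(1)]
  have "(\<integral>\<^sup>+\<mu>. (emeasure \<mu> B + c) ^ Suc m \<partial>law)
      = (\<integral>\<^sup>+\<mu>. (emeasure \<mu> B + c) ^ m * emeasure \<mu> B + c * (emeasure \<mu> B + c) ^ m \<partial>law)"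
    by (simp add: algebra_simps)
  also have "\<dots> = (\<integral>\<^sup>+\<mu>. (emeasure \<mu> B + c) ^ m * emeasure \<mu> B \<partial>law) + c * (\<integral>\<^sup>+\<mu>. (emeasure \<mu> B + c) ^ m \<partial>law)"
    by (subst nn_integral_add) (auto intro!: nn_integral_cmult arg_cong2[where f = "(+)"])
  also have "(\<integral>\<^sup>+\<mu>. (emeasure \<mu> B + c) ^ m * emeasure \<mu> B \<partial>law)
      = (\<integral>\<^sup>+\<mu>. \<integral>\<^sup>+y. (emeasure (add_measure \<mu> (return \<mu> y)) B + c) ^ m * indicator B y \<partial>L \<partial>law)"
    by (rule mecke[OF B, symmetric]) simp
  also have "\<dots> = (\<integral>\<^sup>+\<mu>. \<integral>\<^sup>+y. (emeasure \<mu> B + (1 + c)) ^ m * indicator B y \<partial>L \<partial>law)"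
    by (intro nn_integral_cong)
      (auto simp: space_counting_algebra emeasure_add_dirac B add.assoc indicator_def)
  also have "\<dots> = (\<integral>\<^sup>+\<mu>. (emeasure \<mu> B + (1 + c)) ^ m * emeasure L B \<partial>law)"
    using B by (intro nn_integral_cong nn_integral_cmult_indicator) auto
  also have "\<dots> = (\<integral>\<^sup>+\<mu>. (emeasure \<mu> B + (1 + c)) ^ m \<partial>law) * emeasure L B"
    by (intro nn_integral_multc) simp
  also have "\<dots> + c * (\<integral>\<^sup>+\<mu>. (emeasure \<mu> B + c) ^ m \<partial>law) < \<infinity>"
    using Suc.IH[of "1 + c"] Suc.IH[of c] Suc.prems B(2) by (simp add: ennreal_mult_less_top)
  finally show ?case .
qed

text \<open>The difference is split by the triangle inequality. After integration over
  \<open>B\<close>, the Mecke equation turns the shifted term into one with the extra factor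
  \<open>\<mu>(B)\<close>, while the unshifted term acquires \<open>\<lambda>(B)\<close>; together
  they raise the power of the weight by one.\<close>

lemma diff_op_bound:
  assumes B: "B \<in> sets L" "emeasure L B < \<infinity>"
    and f [measurable]: "f \<in> borel_measurable (counting_algebra L)"
  shows "(\<integral>\<^sup>+z. (\<integral>\<^sup>+\<mu>. ennreal \<bar>diff_op z f \<mu>\<bar> * (emeasure \<mu> B + emeasure L B) ^ n \<partial>law) * indicator B z \<partial>L)
    \<le> (\<integral>\<^sup>+\<mu>. ennreal \<bar>f \<mu>\<bar> * (emeasure \<mu> B + emeasure L B) ^ Suc n \<partial>law)"
proof -
  note mB [measurable] = measurable_emeasure_counting_algebra[OF B(1)]
  note [measurable] = B(1)
  interpret lL: pair_sigma_finite law L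
    by (simp add: pair_sigma_finite_def sigma_finite_L law.sigma_finite_measure_axioms)
  let ?b = "emeasure L B"
  let ?s = "\<lambda>\<mu> y. add_measure \<mu> (return \<mu> y)"
  define G where "G \<mu> = ennreal \<bar>f \<mu>\<bar> * (emeasure \<mu> B + ?b) ^ n" for \<mu>
  have G [measurable]: "G \<in> borel_measurable (counting_algebra L)"
    unfolding G_def[abs_def] by measurable
  have mGs: "(\<lambda>z. G (?s \<mu> z)) \<in> borel_measurable L" if "\<mu> \<in> counting_measures L" for \<mu>
    using that by (intro measurable_compose[OF _ G] measurable_compose[OF _ measurable_add_dirac, unfolded split_conv])
      (simp add: space_counting_algebra)
  have "(\<lambda>x. G (?s (fst x) (snd x))) \<in> borel_measurable (counting_algebra L \<Otimes>\<^sub>M L)"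
    using measurable_compose[OF measurable_add_dirac G] by (simp add: split_def)
  then have mG2: "(\<lambda>(\<mu>, z). (G (?s \<mu> z) + G \<mu>) * indicator B z) \<in> borel_measurable (law \<Otimes>\<^sub>M L)"
    unfolding split_def
    by (subst measurable_cong_sets[OF sets_pair_measure_cong refl]) (auto intro!: borel_measurable_add)
  have "(\<integral>\<^sup>+z. (\<integral>\<^sup>+\<mu>. ennreal \<bar>diff_op z f \<mu>\<bar> * (emeasure \<mu> B + ?b) ^ n \<partial>law) * indicator B z \<partial>L)
      \<le> (\<integral>\<^sup>+z. (\<integral>\<^sup>+\<mu>. (G (?s \<mu> z) + G \<mu>) * indicator B z \<partial>law) \<partial>L)"
  proof (intro nn_integral_mono)
    fix z
    show "(\<integral>\<^sup>+\<mu>. ennreal \<bar>diff_op z f \<mu>\<bar> * (emeasure \<mu> B + ?b) ^ n \<partial>law) * indicator B z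
        \<le> (\<integral>\<^sup>+\<mu>. (G (?s \<mu> z) + G \<mu>) * indicator B z \<partial>law)"
    proof (cases "z \<in> B")
      case True
      have "ennreal \<bar>diff_op z f \<mu>\<bar> * (emeasure \<mu> B + ?b) ^ n \<le> G (?s \<mu> z) + G \<mu>"
        if "\<mu> \<in> counting_measures L" for \<mu>
      proof -
        have "ennreal \<bar>diff_op z f \<mu>\<bar> \<le> ennreal (\<bar>f (?s \<mu> z)\<bar> + \<bar>f \<mu>\<bar>)"
          by (intro ennreal_leI) (auto simp: diff_op_def)
        then have "ennreal \<bar>diff_op z f \<mu>\<bar> * (emeasure \<mu> B + ?b) ^ n
            \<le> (ennreal \<bar>f (?s \<mu> z)\<bar> + ennreal \<bar>f \<mu>\<bar>) * (emeasure \<mu> B + ?b) ^ n"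
          by (intro mult_right_mono) auto
        also have "\<dots> = ennreal \<bar>f (?s \<mu> z)\<bar> * (emeasure \<mu> B + ?b) ^ n + G \<mu>"
          by (simp add: G_def distrib_right)
        \<comment> \<open>An added point only increases the weight, so the weight may be evaluated
          at the shifted configuration, in the form that the Mecke equation takes as input.\<close>
        also have "\<dots> \<le> G (?s \<mu> z) + G \<mu>"
          unfolding G_def using that B
          by (intro add_mono mult_left_mono power_mono order_refl) (auto simp: emeasure_add_dirac)
        finally show ?thesis .
      qed
      then show ?thesis using True by (auto intro!: nn_integral_mono simp: space_counting_algebra)
    qed simp
  qed
  also have "\<dots> = (\<integral>\<^sup>+\<mu>. \<integral>\<^sup>+z. (G (?s \<mu> z) + G \<mu>) * indicator B z \<partial>L \<partial>law)"
    using lL.Fubini'[OF mG2] by simp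
  also have "\<dots> = (\<integral>\<^sup>+\<mu>. (\<integral>\<^sup>+z. G (?s \<mu> z) * indicator B z \<partial>L) + G \<mu> * ?b \<partial>law)"
    using mGs by (intro nn_integral_cong)
      (simp add: distrib_right nn_integral_add nn_integral_cmult_indicator space_counting_algebra)
  also have "\<dots> = (\<integral>\<^sup>+\<mu>. \<integral>\<^sup>+z. G (?s \<mu> z) * indicator B z \<partial>L \<partial>law) + (\<integral>\<^sup>+\<mu>. G \<mu> * ?b \<partial>law)"
  proof (rule nn_integral_add)
    have "(\<lambda>(\<mu>, z). G (?s \<mu> z) * indicator B z) \<in> borel_measurable (law \<Otimes>\<^sub>M L)"
      using measurable_compose[OF measurable_add_dirac G] unfolding split_def
      by (subst measurable_cong_sets[OF sets_pair_measure_cong refl]) auto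
    then show "(\<lambda>\<mu>. \<integral>\<^sup>+z. G (?s \<mu> z) * indicator B z \<partial>L) \<in> borel_measurable law"
      by (rule intensity.borel_measurable_nn_integral)
  qed simp
  also have "(\<integral>\<^sup>+\<mu>. \<integral>\<^sup>+z. G (?s \<mu> z) * indicator B z \<partial>L \<partial>law) = (\<integral>\<^sup>+\<mu>. G \<mu> * emeasure \<mu> B \<partial>law)"
    by (rule mecke[OF B G])
  also have "\<dots> + (\<integral>\<^sup>+\<mu>. G \<mu> * ?b \<partial>law) = (\<integral>\<^sup>+\<mu>. G \<mu> * emeasure \<mu> B + G \<mu> * ?b \<partial>law)"
    by (rule nn_integral_add[symmetric]) simp_all
  also have "\<dots> = (\<integral>\<^sup>+\<mu>. ennreal \<bar>f \<mu>\<bar> * (emeasure \<mu> B + ?b) ^ Suc n \<partial>law)"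
    by (intro nn_integral_cong) (simp add: G_def algebra_simps)
  finally show ?thesis .
qed

lemma measurable_nn_integral_diff_ops:
  assumes f: "f \<in> borel_measurable (counting_algebra L)"
  shows "(\<lambda>y. \<integral>\<^sup>+\<mu>. ennreal \<bar>diff_ops (map y [0..<n]) f \<mu>\<bar> \<partial>law) \<in> borel_measurable (product_power L n)"
proof (rule law.borel_measurable_nn_integral)
  have "(\<lambda>(y, \<mu>). diff_ops (map y [0..<n]) f \<mu>)
      \<in> borel_measurable (PiM {..<n} (\<lambda>_. L) \<Otimes>\<^sub>M counting_algebra L)"
    by (rule measurable_diff_ops_pair[OF f]) auto
  then have "(\<lambda>x. ennreal \<bar>diff_ops (map (fst x) [0..<n]) f (snd x)\<bar>)
      \<in> borel_measurable (PiM {..<n} (\<lambda>_. L) \<Otimes>\<^sub>M counting_algebra L)"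
    unfolding split_def by measurable
  then show "(\<lambda>(y, \<mu>). ennreal \<bar>diff_ops (map y [0..<n]) f \<mu>\<bar>) \<in> borel_measurable (product_power L n \<Otimes>\<^sub>M law)"
    unfolding product_power_def split_def
    by (subst measurable_cong_sets[OF sets_pair_measure_cong refl]) auto
qed

text \<open>Each difference costs one factor of the weight. The induction varies \<open>f\<close>,
  since its hypothesis is applied to a first difference of \<open>f\<close>.\<close>

lemma diff_ops_bound:
  assumes B: "B \<in> sets L" "emeasure L B < \<infinity>"
    and f: "f \<in> borel_measurable (counting_algebra L)"
  shows "(\<integral>\<^sup>+y. (\<integral>\<^sup>+\<mu>. ennreal \<bar>diff_ops (map y [0..<n]) f \<mu>\<bar> \<partial>law) * (\<Prod>i<n. indicator B (y i)) \<partial>product_power L n)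
    \<le> (\<integral>\<^sup>+\<mu>. ennreal \<bar>f \<mu>\<bar> * (emeasure \<mu> B + emeasure L B) ^ n \<partial>law)"
  using f
proof (induction n arbitrary: f)
  case 0
  then show ?case
    using LL.nn_integral_empty[of "\<lambda>y. \<integral>\<^sup>+\<mu>. ennreal \<bar>f \<mu>\<bar> \<partial>law"]
    by (simp add: product_power_def)
next
  case (Suc n)
  note [measurable] = B(1)
  let ?w = "\<lambda>\<mu>. emeasure \<mu> B + emeasure L B"
  let ?F = "\<lambda>y. (\<integral>\<^sup>+\<mu>. ennreal \<bar>diff_ops (map y [0..<Suc n]) f \<mu>\<bar> \<partial>law) * (\<Prod>i<Suc n. indicator B (y i))"
  have mF: "?F \<in> borel_measurable (PiM (insert n {..<n}) (\<lambda>_. L))"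
  proof -
    have [measurable]: "(\<lambda>y. \<integral>\<^sup>+\<mu>. ennreal \<bar>diff_ops (map y [0..<Suc n]) f \<mu>\<bar> \<partial>law)
        \<in> borel_measurable (PiM (insert n {..<n}) (\<lambda>_. L))"
      using measurable_nn_integral_diff_ops[OF Suc.prems, of "Suc n"]
      unfolding product_power_def lessThan_Suc .
    have [measurable]: "(\<lambda>y. \<Prod>i<Suc n. indicator B (y i) :: ennreal)
        \<in> borel_measurable (PiM (insert n {..<n}) (\<lambda>_. L))"
      by (intro borel_measurable_prod_ennreal measurable_compose[OF measurable_component_singleton borel_measurable_indicator] B)
        auto
    show ?thesis by measurable
  qed
  \<comment> \<open>The last coordinate belongs to the innermost operator. Integrating it outermost
    leaves an \<open>n\<close>-fold difference of \<open>diff_op z f\<close> inside.\<close>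
  have eq: "?F (y(n := z)) = ((\<integral>\<^sup>+\<mu>. ennreal \<bar>diff_ops (map y [0..<n]) (diff_op z f) \<mu>\<bar> \<partial>law)
      * (\<Prod>i<n. indicator B (y i))) * indicator B z" for y z
  proof -
    have "map (y(n := z)) [0..<Suc n] = map y [0..<n] @ [z]" by simp
    moreover have "(\<Prod>i<Suc n. indicator B ((y(n := z)) i)) = (\<Prod>i<n. indicator B (y i)) * (indicator B z :: ennreal)"
      by (simp add: lessThan_Suc mult.commute)
    ultimately show ?thesis by (simp add: diff_ops_append mult_ac del: upt_Suc)
  qed
  have "(\<integral>\<^sup>+y. ?F y \<partial>product_power L (Suc n))
      = (\<integral>\<^sup>+z. \<integral>\<^sup>+y. ?F (y(n := z)) \<partial>product_power L n \<partial>L)"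
    using LL.product_nn_integral_insert_rev[OF _ _ mF] by (simp add: product_power_def lessThan_Suc)
  also have "\<dots> \<le> (\<integral>\<^sup>+z. (\<integral>\<^sup>+\<mu>. ennreal \<bar>diff_op z f \<mu>\<bar> * ?w \<mu> ^ n \<partial>law) * indicator B z \<partial>L)"
  proof (intro nn_integral_mono)
    fix z
    have m: "diff_op z f \<in> borel_measurable (counting_algebra L)"
      by (intro measurable_diff_op Suc.prems)
    have [measurable]: "(\<lambda>y. \<Prod>i<n. indicator B (y i) :: ennreal) \<in> borel_measurable (product_power L n)"
      unfolding product_power_def by measurable
    have "(\<integral>\<^sup>+y. ?F (y(n := z)) \<partial>product_power L n)
        = (\<integral>\<^sup>+y. (\<integral>\<^sup>+\<mu>. ennreal \<bar>diff_ops (map y [0..<n]) (diff_op z f) \<mu>\<bar> \<partial>law) * (\<Prod>i<n. indicator B (y i)) \<partial>product_power L n) * indicator B z"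
      unfolding eq using measurable_nn_integral_diff_ops[OF m, of n]
      by (intro nn_integral_multc) simp
    also have "\<dots> \<le> (\<integral>\<^sup>+\<mu>. ennreal \<bar>diff_op z f \<mu>\<bar> * ?w \<mu> ^ n \<partial>law) * indicator B z"
      by (intro mult_right_mono Suc.IH m) simp
    finally show "(\<integral>\<^sup>+y. ?F (y(n := z)) \<partial>product_power L n)
        \<le> (\<integral>\<^sup>+\<mu>. ennreal \<bar>diff_op z f \<mu>\<bar> * ?w \<mu> ^ n \<partial>law) * indicator B z" .
  qed
  also have "\<dots> \<le> (\<integral>\<^sup>+\<mu>. ennreal \<bar>f \<mu>\<bar> * ?w \<mu> ^ Suc n \<partial>law)"
    by (rule diff_op_bound[OF B Suc.prems])
  finally show ?case .
qed

text \<open>The constant \<open>W\<close> is the moment of order \<open>2 * n\<close> of the weight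
  and depends on neither \<open>f\<close> nor \<open>s\<close>. If the squared norm of
  \<open>f\<close> is at most \<open>1 / 4 ^ k\<close>, the choice \<open>s = 2 ^ k\<close> bounds
  the integral over the cube by \<open>(1 + W) / 2 ^ k\<close>.\<close>

lemma diff_ops_L2_bound:
  assumes B: "B \<in> sets L" "emeasure L B < \<infinity>"
  obtains W :: ennreal where "W < \<infinity>"
    "\<And>f s. f \<in> borel_measurable (counting_algebra L) \<Longrightarrow> 0 \<le> s \<Longrightarrow>
      ennreal s * (\<integral>\<^sup>+y. (\<integral>\<^sup>+\<mu>. ennreal \<bar>diff_ops (map y [0..<n]) f \<mu>\<bar> \<partial>law) * (\<Prod>i<n. indicator B (y i)) \<partial>product_power L n)
      \<le> ennreal (s\<^sup>2) * (\<integral>\<^sup>+\<mu>. ennreal ((f \<mu>)\<^sup>2) \<partial>law) + W"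
proof
  let ?w = "\<lambda>\<mu>. (emeasure \<mu> B + emeasure L B) ^ n"
  let ?W = "\<integral>\<^sup>+\<mu>. (emeasure \<mu> B + emeasure L B) ^ (n + n) \<partial>law"
  note mB [measurable] = measurable_emeasure_counting_algebra[OF B(1)]
  show "?W < \<infinity>" by (rule moments_finite[OF B B(2)])
  fix f :: "'a measure \<Rightarrow> real" and s :: real
  assume f [measurable]: "f \<in> borel_measurable (counting_algebra L)" and s: "0 \<le> s"
  have "ennreal s * (\<integral>\<^sup>+y. (\<integral>\<^sup>+\<mu>. ennreal \<bar>diff_ops (map y [0..<n]) f \<mu>\<bar> \<partial>law) * (\<Prod>i<n. indicator B (y i)) \<partial>product_power L n)
      \<le> ennreal s * (\<integral>\<^sup>+\<mu>. ennreal \<bar>f \<mu>\<bar> * ?w \<mu> \<partial>law)"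
    by (intro mult_left_mono diff_ops_bound B f) simp
  also have "\<dots> = (\<integral>\<^sup>+\<mu>. (ennreal s * ennreal \<bar>f \<mu>\<bar>) * ?w \<mu> \<partial>law)"
    by (subst nn_integral_cmult[symmetric]) (simp_all add: mult.assoc)
  also have "\<dots> \<le> (\<integral>\<^sup>+\<mu>. ennreal (s\<^sup>2) * ennreal ((f \<mu>)\<^sup>2) + (emeasure \<mu> B + emeasure L B) ^ (n + n) \<partial>law)"
  proof (intro nn_integral_mono)
    fix \<mu>
    have "(ennreal s * ennreal \<bar>f \<mu>\<bar>) * (ennreal s * ennreal \<bar>f \<mu>\<bar>) = ennreal (s\<^sup>2) * ennreal ((f \<mu>)\<^sup>2)"
      using s by (simp add: ennreal_mult[symmetric] power2_eq_square mult_ac abs_mult[symmetric])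
    then show "(ennreal s * ennreal \<bar>f \<mu>\<bar>) * ?w \<mu>
        \<le> ennreal (s\<^sup>2) * ennreal ((f \<mu>)\<^sup>2) + (emeasure \<mu> B + emeasure L B) ^ (n + n)"
      using ennreal_mult_le_squares[of "ennreal s * ennreal \<bar>f \<mu>\<bar>" "?w \<mu>"]
      by (simp add: power_add)
  qed
  also have "\<dots> = ennreal (s\<^sup>2) * (\<integral>\<^sup>+\<mu>. ennreal ((f \<mu>)\<^sup>2) \<partial>law) + ?W"
    by (subst nn_integral_add) (simp_all add: nn_integral_cmult)
  finally show "ennreal s * (\<integral>\<^sup>+y. (\<integral>\<^sup>+\<mu>. ennreal \<bar>diff_ops (map y [0..<n]) f \<mu>\<bar> \<partial>law) * (\<Prod>i<n. indicator B (y i)) \<partial>product_power L n)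
      \<le> ennreal (s\<^sup>2) * (\<integral>\<^sup>+\<mu>. ennreal ((f \<mu>)\<^sup>2) \<partial>law) + ?W" .
qed

text \<open>Countably many cubes over an exhausting sequence cover the product space. This reduces
  almost everywhere statements to sets of finite intensity, where the Mecke bounds apply.\<close>

lemma AE_product_powerI:
  assumes "\<And>B. B \<in> sets L \<Longrightarrow> emeasure L B < \<infinity> \<Longrightarrow>
    AE y in product_power L n. (\<forall>i<n. y i \<in> B) \<longrightarrow> Q y"
  shows "AE y in product_power L n. Q y"
proof -
  obtain S :: "nat \<Rightarrow> 'a set" where S: "range S \<subseteq> sets L" "(\<Union>i. S i) = space L"
      "\<And>i. emeasure L (S i) \<noteq> \<infinity>" "incseq S"
    using intensity.sigma_finite_incseq by metis
  have "AE y in product_power L n. \<forall>j. (\<forall>i<n. y i \<in> S j) \<longrightarrow> Q y"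
    unfolding AE_all_countable using S(1,3) by (auto intro!: assms simp: less_top)
  moreover have "AE y in product_power L n. \<forall>i<n. y i \<in> space L"
    by (intro AE_I2) (auto simp: product_power_def space_PiM)
  ultimately show ?thesis
  proof eventually_elim
    case (elim y)
    then have "\<forall>i<n. \<exists>j. y i \<in> S j" using S(2) by blast
    then obtain j where j: "\<And>i. i < n \<Longrightarrow> y i \<in> S (j i)" by metis
    \<comment> \<open>The sequence increases and there are finitely many coordinates, so the largest
      index serves for all of them.\<close>
    have "y i \<in> S (Max (j ` {..<n}))" if "i < n" for i
    proof -
      have "j i \<le> Max (j ` {..<n})" using that by (intro Max_ge) auto
      then show ?thesis using j[OF that] incseqD[OF S(4)] by blast
    qed
    then show ?case using elim by blast
  qed
qed

section \<open>The mean differences \<open>T_n f\<close>\<close>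

lemma diff_mean_law:
  assumes "f \<in> borel_measurable (counting_algebra L)"
  shows "diff_mean P \<eta> n f y = (\<integral>\<mu>. diff_ops (map y [0..<n]) f \<mu> \<partial>law)"
  unfolding diff_mean_def
  by (rule integral_distr[OF measurable_process measurable_diff_ops[OF assms], symmetric])

lemma measurable_diff_mean:
  assumes f: "f \<in> borel_measurable (counting_algebra L)"
  shows "diff_mean P \<eta> n f \<in> borel_measurable (product_power L n)"
proof -
  have "(\<lambda>(y, \<mu>). diff_ops (map y [0..<n]) f \<mu>)
      \<in> borel_measurable (PiM {..<n} (\<lambda>_. L) \<Otimes>\<^sub>M counting_algebra L)"
    by (rule measurable_diff_ops_pair[OF f]) auto
  then have "(\<lambda>(y, \<mu>). diff_ops (map y [0..<n]) f \<mu>) \<in> borel_measurable (product_power L n \<Otimes>\<^sub>M law)"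
    unfolding product_power_def
    by (subst measurable_cong_sets[OF sets_pair_measure_cong refl]) auto
  then show ?thesis
    unfolding diff_mean_law[OF f, abs_def] by (rule law.borel_measurable_lebesgue_integral)
qed

lemma diff_mean_scale:
  assumes f: "f \<in> borel_measurable (counting_algebra L)"
  shows "diff_mean P \<eta> n (\<lambda>\<mu>. c * f \<mu>) y = c * diff_mean P \<eta> n f y"
  by (simp add: diff_mean_def diff_ops_scale)

lemma diff_mean_laplace:
  assumes v: "v \<in> test_functions L" and y: "y \<in> space (product_power L n)"
  shows "diff_mean P \<eta> n (laplace v) y = (\<integral>\<mu>. laplace v \<mu> \<partial>law) * (\<Prod>i<n. exp (- v (y i)) - 1)"
proof -
  have ys: "set (map y [0..<n]) \<subseteq> space L"
    using y by (auto simp: product_power_def space_PiM PiE_def Pi_def)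
  have "(\<Prod>y\<leftarrow>map y [0..<n]. exp (- v y) - 1) = (\<Prod>i<n. exp (- v (y i)) - 1)"
    by (simp add: prod.distinct_set_conv_list[of "[0..<n]", simplified, symmetric] atLeast0LessThan comp_def)
  then have "diff_mean P \<eta> n (laplace v) y = (\<integral>\<mu>. (\<Prod>i<n. exp (- v (y i)) - 1) * laplace v \<mu> \<partial>law)"
    unfolding diff_mean_law[OF measurable_laplace[OF v]]
    by (intro Bochner_Integration.integral_cong refl)
      (simp add: diff_ops_laplace[OF v _ ys] space_counting_algebra)
  then show ?thesis by simp
qed

subsection \<open>The isometry on exponential functionals\<close>

text \<open>Integrability is included since Bochner integrals of products are additive only when
  they exist. The series starts at \<open>n = 0\<close>, whose term will be the product of the
  expectations.\<close>

definition fock_isometric :: "('a measure \<Rightarrow> real) \<Rightarrow> ('a measure \<Rightarrow> real) \<Rightarrow> bool" where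
  "fock_isometric f g \<longleftrightarrow>
    (\<forall>n. integrable (product_power L n) (\<lambda>y. diff_mean P \<eta> n f y * diff_mean P \<eta> n g y)) \<and>
    (\<lambda>n. 1 / fact n * L2_inner (product_power L n) (diff_mean P \<eta> n f) (diff_mean P \<eta> n g))
      sums (\<integral>\<mu>. f \<mu> * g \<mu> \<partial>law)"

lemma fock_isometric_commute: "fock_isometric f g \<longleftrightarrow> fock_isometric g f"
  by (simp add: fock_isometric_def L2_inner_def mult.commute)

lemma laplace_span_integrable_diff_ops:
  assumes f: "f \<in> laplace_span L"
  shows "integrable law (diff_ops ys f)"
proof -
  obtain C where C: "\<And>\<mu>. \<bar>f \<mu>\<bar> \<le> C" using laplace_span_bounded[OF f] by blast
  have "AE \<mu> in law. norm (diff_ops ys f \<mu>) \<le> 2 ^ length ys * C"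
    using diff_ops_bounded[of f C ys, OF C] by simp
  then show ?thesis
    using measurable_diff_ops[OF laplace_span_measurable[OF f]]
    by (intro law.integrable_const_bound[where B = "2 ^ length ys * C"]) auto
qed

text \<open>Bounded functionals have bounded differences, so additivity holds at every
  \<open>y\<close>. For general square-integrable functions only the almost everywhere version
  \<open>AE_diff_mean_add\<close> is available.\<close>

lemma diff_mean_add_span:
  assumes "f \<in> laplace_span L" "g \<in> laplace_span L"
  shows "diff_mean P \<eta> n (\<lambda>\<mu>. f \<mu> + g \<mu>) y = diff_mean P \<eta> n f y + diff_mean P \<eta> n g y"
  using laplace_span_integrable_diff_ops[OF assms(1)] laplace_span_integrable_diff_ops[OF assms(2)]
  by (simp add: diff_mean_law laplace_span_measurable assms laplace_span.add diff_ops_add)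

lemma laplace_span_integrable_mult:
  assumes f: "f \<in> laplace_span L" and g: "g \<in> laplace_span L"
  shows "integrable law (\<lambda>\<mu>. f \<mu> * g \<mu>)"
proof -
  obtain C D where C: "\<And>\<mu>. \<bar>f \<mu>\<bar> \<le> C" and D: "\<And>\<mu>. \<bar>g \<mu>\<bar> \<le> D"
    using laplace_span_bounded[OF f] laplace_span_bounded[OF g] by blast
  have "\<bar>f \<mu> * g \<mu>\<bar> \<le> C * D" for \<mu>
    unfolding abs_mult using order_trans[OF abs_ge_zero C] by (intro mult_mono C D) auto
  then show ?thesis
    using laplace_span_measurable[OF f] laplace_span_measurable[OF g]
    by (intro law.integrable_const_bound[where B = "C * D"]) auto
qed

lemma fock_isometric_add:
  assumes f: "f \<in> laplace_span L" and g: "g \<in> laplace_span L" and h: "h \<in> laplace_span L"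
    and fh: "fock_isometric f h" and gh: "fock_isometric g h"
  shows "fock_isometric (\<lambda>\<mu>. f \<mu> + g \<mu>) h"
proof -
  have "(\<lambda>n. 1 / fact n * L2_inner (product_power L n) (diff_mean P \<eta> n f) (diff_mean P \<eta> n h)
      + 1 / fact n * L2_inner (product_power L n) (diff_mean P \<eta> n g) (diff_mean P \<eta> n h))
    sums ((\<integral>\<mu>. f \<mu> * h \<mu> \<partial>law) + (\<integral>\<mu>. g \<mu> * h \<mu> \<partial>law))"
    using fh gh by (intro sums_add) (auto simp: fock_isometric_def)
  moreover have "(\<integral>\<mu>. (f \<mu> + g \<mu>) * h \<mu> \<partial>law) = (\<integral>\<mu>. f \<mu> * h \<mu> \<partial>law) + (\<integral>\<mu>. g \<mu> * h \<mu> \<partial>law)"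
    using laplace_span_integrable_mult[OF f h] laplace_span_integrable_mult[OF g h]
    by (simp add: distrib_right)
  ultimately show ?thesis
    using fh gh
    by (simp add: fock_isometric_def L2_inner_def diff_mean_add_span[OF f g, abs_def] distrib_right add_divide_distrib)
qed

lemma fock_isometric_scale:
  assumes f: "f \<in> laplace_span L" and fh: "fock_isometric f h"
  shows "fock_isometric (\<lambda>\<mu>. c * f \<mu>) h"
proof -
  have "(\<lambda>n. c * (1 / fact n * L2_inner (product_power L n) (diff_mean P \<eta> n f) (diff_mean P \<eta> n h)))
    sums (c * (\<integral>\<mu>. f \<mu> * h \<mu> \<partial>law))"
    using fh by (intro sums_mult) (auto simp: fock_isometric_def)
  then show ?thesis
    using fh
    by (simp add: fock_isometric_def L2_inner_def diff_mean_scale[OF laplace_span_measurable[OF f], abs_def] mult.assoc)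
qed

lemma fock_isometric_laplace:
  assumes v: "v \<in> test_functions L" and w: "w \<in> test_functions L"
  shows "fock_isometric (laplace v) (laplace w)"
proof -
  let ?E = "\<lambda>v. \<integral>\<mu>. laplace v \<mu> \<partial>law"
  let ?p = "\<lambda>y. (exp (- v y) - 1) * (exp (- w y) - 1)"
  define c where "c = (\<integral>y. ?p y \<partial>L)"
  note vw = test_functions_add[OF v w]
  note i1 = integrable_test_function[OF v] and i2 = integrable_test_function[OF w]
    and i3 = integrable_test_function[OF vw]
  \<comment> \<open>This rearrangement makes \<open>c\<close> the amount by which the Laplace
    exponents of \<open>v\<close> and \<open>w\<close> together exceed that of \<open>v + w\<close>;
    hence the mixed expectation is the product of the two expectations times
    \<open>exp c\<close>.\<close>
  have p: "?p y = (1 - exp (- v y)) + (1 - exp (- w y)) - (1 - exp (- (v y + w y)))" for y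
    by (simp add: algebra_simps mult_exp_exp)
  have intp: "integrable L ?p"
    unfolding p by (intro Bochner_Integration.integrable_add Bochner_Integration.integrable_diff i1 i2 i3)
  have c: "c = (\<integral>y. 1 - exp (- v y) \<partial>L) + (\<integral>y. 1 - exp (- w y) \<partial>L) - (\<integral>y. 1 - exp (- (v y + w y)) \<partial>L)"
    unfolding c_def p Bochner_Integration.integral_diff[OF Bochner_Integration.integrable_add[OF i1 i2] i3]
      Bochner_Integration.integral_add[OF i1 i2] ..
  have eq: "diff_mean P \<eta> n (laplace v) y * diff_mean P \<eta> n (laplace w) y = ?E v * ?E w * (\<Prod>i<n. ?p (y i))"
    if "y \<in> space (product_power L n)" for n y
    by (simp add: diff_mean_laplace[OF v that] diff_mean_laplace[OF w that] prod.distrib)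
  have intP: "integrable (product_power L n) (\<lambda>y. \<Prod>i<n. ?p (y i))" for n
    unfolding product_power_def by (intro LL.product_integrable_prod intp) simp
  have int: "integrable (product_power L n) (\<lambda>y. diff_mean P \<eta> n (laplace v) y * diff_mean P \<eta> n (laplace w) y)" for n
    by (subst Bochner_Integration.integrable_cong[OF refl eq]) (auto intro!: intP)
  have inner: "L2_inner (product_power L n) (diff_mean P \<eta> n (laplace v)) (diff_mean P \<eta> n (laplace w))
      = ?E v * ?E w * c ^ n" for n
  proof -
    have "L2_inner (product_power L n) (diff_mean P \<eta> n (laplace v)) (diff_mean P \<eta> n (laplace w))
        = (\<integral>y. ?E v * ?E w * (\<Prod>i<n. ?p (y i)) \<partial>product_power L n)"
      unfolding L2_inner_def by (intro Bochner_Integration.integral_cong refl eq)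
    also have "\<dots> = ?E v * ?E w * (\<integral>y. (\<Prod>i<n. ?p (y i)) \<partial>product_power L n)"
      by (rule integral_mult_right_zero)
    also have "(\<integral>y. (\<Prod>i<n. ?p (y i)) \<partial>product_power L n) = (\<Prod>i<n. c)"
      unfolding product_power_def c_def by (intro LL.product_integral_prod intp) simp
    finally show ?thesis by simp
  qed
  have "(\<integral>\<mu>. laplace v \<mu> * laplace w \<mu> \<partial>law) = ?E (\<lambda>y. v y + w y)"
    by (intro Bochner_Integration.integral_cong refl)
      (simp add: space_counting_algebra laplace_add[OF v w counting_measuresD(1)])
  also have "\<dots> = ?E v * ?E w * exp c"
    by (simp add: expectation_laplace v w vw c flip: exp_add)
  finally have E: "(\<integral>\<mu>. laplace v \<mu> * laplace w \<mu> \<partial>law) = ?E v * ?E w * exp c" .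
  have "(\<lambda>n. ?E v * ?E w * (c ^ n /\<^sub>R fact n)) sums (?E v * ?E w * exp c)"
    by (intro sums_mult exp_converges)
  then show ?thesis
    unfolding fock_isometric_def inner E using int by (simp add: divide_inverse mult_ac)
qed

lemma fock_isometric_laplace_span:
  assumes f: "f \<in> laplace_span L" and g: "g \<in> laplace_span L"
  shows "fock_isometric f g"
  using f
proof (induction rule: laplace_span.induct)
  case (laplace v)
  have "fock_isometric g (laplace v)"
    using g
  proof (induction rule: laplace_span.induct)
    case (laplace w)
    then show ?case by (intro fock_isometric_laplace \<open>v \<in> test_functions L\<close>)
  next
    case (add g1 g2)
    then show ?case by (intro fock_isometric_add laplace_span.laplace \<open>v \<in> test_functions L\<close>)
  next
    case (scale g1 c)
    then show ?case by (intro fock_isometric_scale)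
  qed
  then show ?case by (simp add: fock_isometric_commute)
next
  case (add f1 f2)
  then show ?case by (intro fock_isometric_add g)
next
  case (scale f1 c)
  then show ?case by (intro fock_isometric_scale)
qed

subsection \<open>Density of exponential functionals\<close>

text \<open>Membership in L2 is part of the definition: a square that is not integrable has Bochner
  integral 0 and would count as approximated.\<close>

definition span_approximable :: "('a measure \<Rightarrow> real) \<Rightarrow> bool" where
  "span_approximable f \<longleftrightarrow> f \<in> L2_space law \<and>
    (\<forall>\<epsilon>>0. \<exists>g\<in>laplace_span L. (\<integral>\<mu>. (f \<mu> - g \<mu>)\<^sup>2 \<partial>law) < \<epsilon>)"

lemma laplace_span_L2:
  assumes g: "g \<in> laplace_span L"
  shows "g \<in> L2_space law"
proof -
  obtain C where C: "\<And>\<mu>. \<bar>g \<mu>\<bar> \<le> C" using laplace_span_bounded[OF g] by blast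
  show ?thesis
    by (rule law.L2_bounded[where C = C]) (simp_all add: laplace_span_measurable[OF g] C)
qed

lemma span_approximable_limit:
  assumes f: "f \<in> L2_space law"
    and lim: "\<And>\<epsilon>. 0 < \<epsilon> \<Longrightarrow> \<exists>h. span_approximable h \<and> (\<integral>\<mu>. (f \<mu> - h \<mu>)\<^sup>2 \<partial>law) < \<epsilon>"
  shows "span_approximable f"
  unfolding span_approximable_def
proof (intro conjI allI impI f)
  fix \<epsilon> :: real assume "0 < \<epsilon>"
  then obtain h where h: "span_approximable h" "(\<integral>\<mu>. (f \<mu> - h \<mu>)\<^sup>2 \<partial>law) < \<epsilon> / 4"
    using lim[of "\<epsilon> / 4"] by auto
  then obtain g where g: "g \<in> laplace_span L" "(\<integral>\<mu>. (h \<mu> - g \<mu>)\<^sup>2 \<partial>law) < \<epsilon> / 4"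
    using \<open>0 < \<epsilon>\<close> by (auto simp: span_approximable_def dest: spec[of _ "\<epsilon> / 4"])
  have hL: "h \<in> L2_space law" using h by (simp add: span_approximable_def)
  have "(\<integral>\<mu>. (f \<mu> - g \<mu>)\<^sup>2 \<partial>law) = (\<integral>\<mu>. ((f \<mu> - h \<mu>) + (h \<mu> - g \<mu>))\<^sup>2 \<partial>law)" by simp
  also have "\<dots> \<le> 2 * (\<integral>\<mu>. (f \<mu> - h \<mu>)\<^sup>2 \<partial>law) + 2 * (\<integral>\<mu>. (h \<mu> - g \<mu>)\<^sup>2 \<partial>law)"
    by (intro integral_square_add_le L2_diff f hL laplace_span_L2 g)
  also have "\<dots> < \<epsilon>" using h(2) g(2) by linarith
  finally show "\<exists>g\<in>laplace_span L. (\<integral>\<mu>. (f \<mu> - g \<mu>)\<^sup>2 \<partial>law) < \<epsilon>" using g(1) by blast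
qed

lemma span_approximable_span:
  assumes g: "g \<in> laplace_span L"
  shows "span_approximable g"
  unfolding span_approximable_def using laplace_span_L2[OF g]
  by (auto intro!: bexI[OF _ g])

lemma span_approximable_add:
  assumes f: "span_approximable f" and g: "span_approximable g"
  shows "span_approximable (\<lambda>\<mu>. f \<mu> + g \<mu>)"
  unfolding span_approximable_def
proof (intro conjI allI impI)
  have fL: "f \<in> L2_space law" and gL: "g \<in> L2_space law"
    using f g by (simp_all add: span_approximable_def)
  then show "(\<lambda>\<mu>. f \<mu> + g \<mu>) \<in> L2_space law" by (rule L2_add)
  fix \<epsilon> :: real assume "0 < \<epsilon>"
  then obtain f' g' where f': "f' \<in> laplace_span L" "(\<integral>\<mu>. (f \<mu> - f' \<mu>)\<^sup>2 \<partial>law) < \<epsilon> / 4"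
    and g': "g' \<in> laplace_span L" "(\<integral>\<mu>. (g \<mu> - g' \<mu>)\<^sup>2 \<partial>law) < \<epsilon> / 4"
    using f g unfolding span_approximable_def by (meson divide_pos_pos zero_less_numeral)
  have "(\<integral>\<mu>. (f \<mu> + g \<mu> - (f' \<mu> + g' \<mu>))\<^sup>2 \<partial>law) = (\<integral>\<mu>. ((f \<mu> - f' \<mu>) + (g \<mu> - g' \<mu>))\<^sup>2 \<partial>law)"
    by (simp add: algebra_simps)
  also have "\<dots> \<le> 2 * (\<integral>\<mu>. (f \<mu> - f' \<mu>)\<^sup>2 \<partial>law) + 2 * (\<integral>\<mu>. (g \<mu> - g' \<mu>)\<^sup>2 \<partial>law)"
    by (intro integral_square_add_le L2_diff fL gL laplace_span_L2 f' g')
  also have "\<dots> < \<epsilon>" using f'(2) g'(2) by linarith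
  finally show "\<exists>h\<in>laplace_span L. (\<integral>\<mu>. (f \<mu> + g \<mu> - h \<mu>)\<^sup>2 \<partial>law) < \<epsilon>"
    using laplace_span.add[OF f'(1) g'(1)] by (intro bexI[of _ "\<lambda>\<mu>. f' \<mu> + g' \<mu>"])
qed

lemma span_approximable_scale:
  assumes f: "span_approximable f"
  shows "span_approximable (\<lambda>\<mu>. c * f \<mu>)"
  unfolding span_approximable_def
proof (intro conjI allI impI)
  show "(\<lambda>\<mu>. c * f \<mu>) \<in> L2_space law"
    using f by (intro L2_scale) (simp add: span_approximable_def)
  fix \<epsilon> :: real assume "0 < \<epsilon>"
  \<comment> \<open>Adding 1 to \<open>c\<^sup>2\<close> avoids a division by zero when
    \<open>c = 0\<close>.\<close>
  moreover have c: "0 < c\<^sup>2 + 1" by (simp add: add_nonneg_pos)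
  ultimately obtain f' where f': "f' \<in> laplace_span L" "(\<integral>\<mu>. (f \<mu> - f' \<mu>)\<^sup>2 \<partial>law) < \<epsilon> / (c\<^sup>2 + 1)"
    using f unfolding span_approximable_def by (meson divide_pos_pos)
  have "(\<integral>\<mu>. (c * f \<mu> - c * f' \<mu>)\<^sup>2 \<partial>law) = c\<^sup>2 * (\<integral>\<mu>. (f \<mu> - f' \<mu>)\<^sup>2 \<partial>law)"
    by (simp add: power_mult_distrib flip: right_diff_distrib)
  also have "\<dots> \<le> (c\<^sup>2 + 1) * (\<integral>\<mu>. (f \<mu> - f' \<mu>)\<^sup>2 \<partial>law)"
    by (intro mult_right_mono) auto
  also have "\<dots> < \<epsilon>" using f'(2) c by (simp add: field_simps)
  finally show "\<exists>h\<in>laplace_span L. (\<integral>\<mu>. (c * f \<mu> - h \<mu>)\<^sup>2 \<partial>law) < \<epsilon>"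
    using laplace_span.scale[OF f'(1), of c] by (intro bexI[of _ "\<lambda>\<mu>. c * f' \<mu>"])
qed

lemma span_approximable_sum:
  assumes "\<And>i. i \<in> I \<Longrightarrow> span_approximable (F i)"
  shows "span_approximable (\<lambda>\<mu>. \<Sum>i\<in>I. F i \<mu>)"
  using assms
  by (induction I rule: infinite_finite_induct)
    (simp_all add: span_approximable_add span_approximable_span laplace_span_const)

lemma span_approximable_dominated_limit:
  assumes F: "\<And>i :: nat. span_approximable (F i)"
    and f: "f \<in> L2_space law" and w: "integrable law w"
    and lim: "\<And>\<mu>. \<mu> \<in> counting_measures L \<Longrightarrow> (\<lambda>i. F i \<mu>) \<longlonglongrightarrow> f \<mu>"
    and dom: "\<And>i \<mu>. \<mu> \<in> counting_measures L \<Longrightarrow> (f \<mu> - F i \<mu>)\<^sup>2 \<le> w \<mu>"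
  shows "span_approximable f"
proof (rule span_approximable_limit[OF f])
  fix \<epsilon> :: real assume "0 < \<epsilon>"
  have m: "F i \<in> borel_measurable law" "f \<in> borel_measurable law" for i
    using F[of i] f by (simp_all add: span_approximable_def L2_space_def)
  have "(\<lambda>i. \<integral>\<mu>. (f \<mu> - F i \<mu>)\<^sup>2 \<partial>law) \<longlonglongrightarrow> (\<integral>\<mu>. 0 \<partial>law)"
  proof (rule integral_dominated_convergence[OF _ _ w])
    show "AE \<mu> in law. (\<lambda>i. (f \<mu> - F i \<mu>)\<^sup>2) \<longlonglongrightarrow> 0"
    proof (rule AE_I2)
      fix \<mu> assume "\<mu> \<in> space law"
      then have "(\<lambda>i. (f \<mu> - F i \<mu>)\<^sup>2) \<longlonglongrightarrow> (f \<mu> - f \<mu>)\<^sup>2"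
        by (intro tendsto_intros lim) (simp add: space_counting_algebra)
      then show "(\<lambda>i. (f \<mu> - F i \<mu>)\<^sup>2) \<longlonglongrightarrow> 0" by simp
    qed
    show "AE \<mu> in law. norm ((f \<mu> - F i \<mu>)\<^sup>2) \<le> w \<mu>" for i
      using dom[of _ i] by (intro AE_I2) (simp add: space_counting_algebra)
    show "(\<lambda>\<mu>. (f \<mu> - F i \<mu>)\<^sup>2) \<in> borel_measurable law" for i
      by (intro borel_measurable_power borel_measurable_diff m)
  qed simp
  then have "eventually (\<lambda>i. (\<integral>\<mu>. (f \<mu> - F i \<mu>)\<^sup>2 \<partial>law) < \<epsilon>) sequentially"
    using \<open>0 < \<epsilon>\<close> by (intro order_tendstoD) auto
  then obtain i where "(\<integral>\<mu>. (f \<mu> - F i \<mu>)\<^sup>2 \<partial>law) < \<epsilon>"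
    by (auto simp: eventually_sequentially)
  then show "\<exists>h. span_approximable h \<and> (\<integral>\<mu>. (f \<mu> - h \<mu>)\<^sup>2 \<partial>law) < \<epsilon>"
    using F by blast
qed

lemma span_approximable_indicator:
  assumes "A \<in> sets (counting_algebra L)"
  shows "span_approximable (indicator A)"
  using sigma_finite_L assms
proof (induction rule: laplace_span_induct_indicator)
  case (lim F f C)
  have mF: "F i \<in> borel_measurable (counting_algebra L)" for i
    using lim(1)[of i] by (simp add: span_approximable_def L2_space_def)
  have m: "f \<in> borel_measurable (counting_algebra L)"
    by (rule borel_measurable_LIMSEQ_real[OF lim(3) mF]) (simp add: space_counting_algebra)
  have bd: "\<bar>f \<mu>\<bar> \<le> C" if "\<mu> \<in> counting_measures L" for \<mu>
    by (rule LIMSEQ_le_const2[OF tendsto_rabs[OF lim(3)[OF that]]]) (use lim(2) that in auto)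
  show ?case
  proof (rule span_approximable_dominated_limit[OF lim(1)])
    show "f \<in> L2_space law"
      using m bd by (intro law.L2_bounded[where C = C] AE_I2) (auto simp: space_counting_algebra)
    show "integrable law (\<lambda>_. (2 * C)\<^sup>2)" by simp
    show "(f \<mu> - F i \<mu>)\<^sup>2 \<le> (2 * C)\<^sup>2" if "\<mu> \<in> counting_measures L" for i \<mu>
      using bd[OF that] lim(2)[OF that, of i] by (intro power2_le_iff_abs_le[THEN iffD2]) linarith+
  qed (rule lim(3))
qed (auto intro: span_approximable_span span_approximable_add span_approximable_scale)

lemma span_approximable_L2:
  assumes f: "f \<in> L2_space law"
  shows "span_approximable f"
proof -
  obtain s where s: "\<And>i::nat. simple_function law (s i)"
    and lim: "\<And>\<mu>. \<mu> \<in> space law \<Longrightarrow> (\<lambda>i. s i \<mu>) \<longlonglongrightarrow> f \<mu>"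
    and dom: "\<And>i \<mu>. \<mu> \<in> space law \<Longrightarrow> dist (s i \<mu>) 0 \<le> 2 * dist (f \<mu>) 0"
    using borel_measurable_implies_sequence_metric[OF L2_measurable[OF f], of 0] by blast
  define F where "F i \<mu> = (\<Sum>c\<in>s i ` space law. c * indicator (s i -` {c} \<inter> space law) \<mu>)" for i \<mu>
  have Fs: "F i \<mu> = s i \<mu>" if "\<mu> \<in> space law" for i \<mu>
  proof -
    have "F i \<mu> = (\<Sum>c\<in>s i ` space law. if s i \<mu> = c then c else 0)"
      unfolding F_def using that by (intro sum.cong) (auto simp: indicator_def)
    then show ?thesis
      using that s[of i] by (simp add: simple_function_def)
  qed
  have F: "span_approximable (F i)" for i
    unfolding F_def[abs_def]
  proof (intro span_approximable_sum span_approximable_scale span_approximable_indicator)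
    fix c show "s i -` {c} \<inter> space law \<in> sets (counting_algebra L)"
      using simple_functionD(2)[OF s[of i], of "{c}"] by simp
  qed
  show ?thesis
  proof (rule span_approximable_dominated_limit[OF F f])
    \<comment> \<open>The simple approximants satisfy
      \<open>\<bar>s i \<mu>\<bar> \<le> 2 * \<bar>f \<mu>\<bar>\<close>, so the error is at most
      \<open>3 * \<bar>f \<mu>\<bar>\<close>; squaring gives the 9.\<close>
    show "integrable law (\<lambda>\<mu>. 9 * (f \<mu>)\<^sup>2)"
      using L2_integrable_square[OF f] by simp
    fix \<mu> assume "\<mu> \<in> counting_measures L"
    then have \<mu>: "\<mu> \<in> space law" by (simp add: space_counting_algebra)
    show "(\<lambda>i. F i \<mu>) \<longlonglongrightarrow> f \<mu>" using lim[OF \<mu>] by (simp add: Fs[OF \<mu>])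
    fix i
    have "\<bar>f \<mu> - F i \<mu>\<bar> \<le> 3 * \<bar>f \<mu>\<bar>"
      using dom[OF \<mu>, of i] by (simp add: Fs[OF \<mu>])
    then have "\<bar>f \<mu> - F i \<mu>\<bar>\<^sup>2 \<le> (3 * \<bar>f \<mu>\<bar>)\<^sup>2" by (intro power_mono) auto
    then show "(f \<mu> - F i \<mu>)\<^sup>2 \<le> 9 * (f \<mu>)\<^sup>2" by (simp add: power_mult_distrib)
  qed
qed

subsection \<open>Passage to the limit\<close>

lemma measurable_diff_ops_on_cube:
  assumes B: "B \<in> sets L" and f: "f \<in> borel_measurable (counting_algebra L)"
  shows "(\<lambda>y. (\<integral>\<^sup>+\<mu>. ennreal \<bar>diff_ops (map y [0..<n]) f \<mu>\<bar> \<partial>law) * (\<Prod>i<n. indicator B (y i)))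
    \<in> borel_measurable (product_power L n)"
proof -
  note [measurable] = measurable_nn_integral_diff_ops[OF f, of n]
  have [measurable]: "(\<lambda>y. \<Prod>i<n. indicator B (y i) :: ennreal) \<in> borel_measurable (product_power L n)"
    unfolding product_power_def
    by (intro borel_measurable_prod_ennreal measurable_compose[OF measurable_component_singleton borel_measurable_indicator] B)
      auto
  show ?thesis by measurable
qed

text \<open>With \<open>s = 1\<close> the bound makes the integral over each cube finite, so the
  inner expectation is finite almost everywhere. This keeps the default value of
  \<open>diff_mean\<close> off all but a null set and makes it linear there.\<close>

lemma AE_integrable_diff_ops:
  assumes f: "f \<in> L2_space law"
  shows "AE y in product_power L n. integrable law (diff_ops (map y [0..<n]) f)"
proof (rule AE_product_powerI)
  fix B assume B: "B \<in> sets L" "emeasure L B < \<infinity>"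
  have m: "f \<in> borel_measurable (counting_algebra L)" using L2_measurable[OF f] by simp
  let ?I = "\<lambda>y. \<integral>\<^sup>+\<mu>. ennreal \<bar>diff_ops (map y [0..<n]) f \<mu>\<bar> \<partial>law"
  let ?J = "\<lambda>y. ?I y * (\<Prod>i<n. indicator B (y i))"
  obtain W :: ennreal where W: "W < \<infinity>"
    "ennreal 1 * (\<integral>\<^sup>+y. ?J y \<partial>product_power L n)
      \<le> ennreal (1\<^sup>2) * (\<integral>\<^sup>+\<mu>. ennreal ((f \<mu>)\<^sup>2) \<partial>law) + W"
  proof (rule diff_ops_L2_bound[OF B, of n], goal_cases)
    case (1 W)
    from 1(2) 1(3)[OF m zero_le_one] show ?case by (rule 1(1))
  qed
  have "(\<integral>\<^sup>+\<mu>. ennreal ((f \<mu>)\<^sup>2) \<partial>law) < \<infinity>"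
    using L2_integrable_square[OF f] by (simp add: nn_integral_eq_integral)
  then have "(\<integral>\<^sup>+y. ?J y \<partial>product_power L n) < \<infinity>"
    using W by (auto simp: less_top[symmetric] top_unique)
  moreover have "?J \<in> borel_measurable (product_power L n)"
    by (rule measurable_diff_ops_on_cube[OF B(1) m])
  ultimately have "AE y in product_power L n. ?J y \<noteq> \<infinity>"
    by (intro nn_integral_noteq_infinite) auto
  then show "AE y in product_power L n. (\<forall>i<n. y i \<in> B) \<longrightarrow> integrable law (diff_ops (map y [0..<n]) f)"
  proof eventually_elim
    case (elim y)
    show ?case
    proof
      assume "\<forall>i<n. y i \<in> B"
      then have "?I y < \<infinity>" using elim by (simp add: less_top)
      then show "integrable law (diff_ops (map y [0..<n]) f)"
        using measurable_diff_ops[OF m] by (intro integrableI_bounded) auto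
    qed
  qed
qed

lemma L2_borel: "f \<in> L2_space law \<Longrightarrow> f \<in> borel_measurable (counting_algebra L)"
  using L2_measurable[of f law] by simp

lemma nn_integral_square:
  "f \<in> L2_space law \<Longrightarrow> (\<integral>\<^sup>+\<mu>. ennreal ((f \<mu>)\<^sup>2) \<partial>law) = ennreal (\<integral>\<mu>. (f \<mu>)\<^sup>2 \<partial>law)"
  by (intro nn_integral_eq_integral L2_integrable_square) auto

text \<open>A Borel-Cantelli type argument: the errors have summable integrals over each cube, so
  their series is finite almost everywhere and its terms tend to 0. The rate
  \<open>(1 / 4) ^ k\<close> is matched to the scaling \<open>s = 2 ^ k\<close>.\<close>

lemma AE_diff_mean_tendsto:
  assumes f: "f \<in> L2_space law" and F: "\<And>k. F k \<in> L2_space law"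
    and close: "\<And>k::nat. (\<integral>\<mu>. (f \<mu> - F k \<mu>)\<^sup>2 \<partial>law) \<le> (1 / 4) ^ k"
  shows "AE y in product_power L n. (\<lambda>k. diff_mean P \<eta> n (F k) y) \<longlonglongrightarrow> diff_mean P \<eta> n f y"
proof (rule AE_product_powerI)
  fix B assume B: "B \<in> sets L" "emeasure L B < \<infinity>"
  define r where "r k \<mu> = f \<mu> - F k \<mu>" for k \<mu>
  have r: "r k \<in> L2_space law" for k
    unfolding r_def[abs_def] by (intro L2_diff f F)
  define I where "I k y = (\<integral>\<^sup>+\<mu>. ennreal \<bar>diff_ops (map y [0..<n]) (r k) \<mu>\<bar> \<partial>law)" for k y
  define J where "J k y = I k y * (\<Prod>i<n. indicator B (y i))" for k y
  have mJ: "J k \<in> borel_measurable (product_power L n)" for k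
    unfolding J_def[abs_def] I_def by (rule measurable_diff_ops_on_cube[OF B(1) L2_borel[OF r]])
  obtain W :: ennreal where W: "W < \<infinity>"
    and bound: "\<And>k. ennreal (2 ^ k) * (\<integral>\<^sup>+y. J k y \<partial>product_power L n)
      \<le> ennreal ((2 ^ k)\<^sup>2) * (\<integral>\<^sup>+\<mu>. ennreal ((r k \<mu>)\<^sup>2) \<partial>law) + W"
  proof (rule diff_ops_L2_bound[OF B, of n], goal_cases)
    case (1 W)
    have "ennreal (2 ^ k) * (\<integral>\<^sup>+y. J k y \<partial>product_power L n)
        \<le> ennreal ((2 ^ k)\<^sup>2) * (\<integral>\<^sup>+\<mu>. ennreal ((r k \<mu>)\<^sup>2) \<partial>law) + W" for k
      using 1(3)[OF L2_borel[OF r[of k]], of "2 ^ k"] by (simp add: J_def I_def)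
    with 1(2) show ?case by (rule 1(1))
  qed
  have J: "(\<integral>\<^sup>+y. J k y \<partial>product_power L n) \<le> ennreal ((1 / 2) ^ k) * (1 + W)" for k
  proof -
    have "ennreal ((2 ^ k)\<^sup>2) * (\<integral>\<^sup>+\<mu>. ennreal ((r k \<mu>)\<^sup>2) \<partial>law) \<le> ennreal ((2 ^ k)\<^sup>2) * ennreal ((1 / 4) ^ k)"
      unfolding nn_integral_square[OF r] using close[of k]
      by (intro mult_left_mono ennreal_leI) (auto simp: r_def)
    also have "\<dots> = ennreal ((2 ^ k)\<^sup>2 * (1 / 4) ^ k)" by (rule ennreal_mult[symmetric]) auto
    also have "(2 ^ k)\<^sup>2 * (1 / 4 :: real) ^ k = 1"
      by (simp add: power2_eq_square flip: power_mult_distrib)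
    finally have "ennreal (2 ^ k) * (\<integral>\<^sup>+y. J k y \<partial>product_power L n) \<le> 1 + W"
      using bound[of k] by (auto intro: order_trans add_right_mono)
    then have "ennreal ((1 / 2) ^ k) * (ennreal (2 ^ k) * (\<integral>\<^sup>+y. J k y \<partial>product_power L n))
        \<le> ennreal ((1 / 2) ^ k) * (1 + W)"
      by (intro mult_left_mono) auto
    moreover have "ennreal ((1 / 2) ^ k) * ennreal (2 ^ k) = 1"
      by (simp flip: ennreal_mult power_mult_distrib)
    ultimately show ?thesis by (simp flip: mult.assoc)
  qed
  have "(\<integral>\<^sup>+y. (\<Sum>k. J k y) \<partial>product_power L n) = (\<Sum>k. \<integral>\<^sup>+y. J k y \<partial>product_power L n)"
    by (rule nn_integral_suminf) (rule mJ)
  also have "\<dots> \<le> (\<Sum>k. ennreal ((1 / 2) ^ k) * (1 + W))"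
    by (intro suminf_le J) auto
  also have "\<dots> = (\<Sum>k. ennreal ((1 / 2) ^ k)) * (1 + W)"
    by (rule ennreal_suminf_multc)
  also have "\<dots> < \<infinity>"
  proof -
    have "(\<Sum>k. ennreal ((1 / 2) ^ k)) \<noteq> top"
      by (intro ennreal_suminf_neq_top summable_geometric) auto
    then show ?thesis using W by (simp add: ennreal_mult_less_top less_top)
  qed
  finally have "AE y in product_power L n. (\<Sum>k. J k y) \<noteq> \<infinity>"
    using mJ by (intro nn_integral_noteq_infinite borel_measurable_suminf_order) auto
  moreover have "AE y in product_power L n. \<forall>k. integrable law (diff_ops (map y [0..<n]) (F k))"
    unfolding AE_all_countable by (intro allI AE_integrable_diff_ops F)
  ultimately show "AE y in product_power L n. (\<forall>i<n. y i \<in> B) \<longrightarrow>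
      (\<lambda>k. diff_mean P \<eta> n (F k) y) \<longlonglongrightarrow> diff_mean P \<eta> n f y"
    using AE_integrable_diff_ops[OF f, of n]
  proof eventually_elim
    case (elim y)
    show ?case
    proof
      assume "\<forall>i<n. y i \<in> B"
      then have JI: "J k y = I k y" for k by (simp add: J_def)
      let ?D = "diff_ops (map y [0..<n])"
      define a where "a k = (\<integral>\<mu>. \<bar>?D (r k) \<mu>\<bar> \<partial>law)" for k
      have Dr: "?D (r k) \<mu> = ?D f \<mu> - ?D (F k) \<mu>" for k \<mu>
        unfolding r_def[abs_def] by (rule diff_ops_diff)
      have ir: "integrable law (?D (r k))" for k
        unfolding Dr using elim by auto
      have "I k y = ennreal (a k)" for k
        unfolding I_def a_def using ir by (intro nn_integral_eq_integral) auto
      then have "(\<Sum>k. ennreal (a k)) \<noteq> top" using elim(1) by (simp add: JI)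
      then have "summable a"
        by (intro summable_suminf_not_top) (auto simp: a_def)
      then have a: "a \<longlonglongrightarrow> 0" by (rule summable_LIMSEQ_zero)
      have "norm (diff_mean P \<eta> n (F k) y - diff_mean P \<eta> n f y) \<le> a k" for k
      proof -
        have "diff_mean P \<eta> n f y - diff_mean P \<eta> n (F k) y = (\<integral>\<mu>. ?D (r k) \<mu> \<partial>law)"
          unfolding diff_mean_law[OF L2_borel[OF f]] diff_mean_law[OF L2_borel[OF F]] Dr
          using elim by simp
        also have "norm \<dots> \<le> a k"
          unfolding a_def using integral_norm_bound[of law "?D (r k)"] by simp
        finally show ?thesis by (simp add: norm_minus_commute)
      qed
      then have "(\<lambda>k. diff_mean P \<eta> n (F k) y - diff_mean P \<eta> n f y) \<longlonglongrightarrow> 0"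
        by (intro Lim_null_comparison[OF _ a]) auto
      then show "(\<lambda>k. diff_mean P \<eta> n (F k) y) \<longlonglongrightarrow> diff_mean P \<eta> n f y"
        by (rule LIM_zero_cancel)
    qed
  qed
qed

text \<open>Values in \<open>ennreal\<close> make the squared norm meaningful before
  \<open>T_n f\<close> is known to be square-integrable, and make Fatou's lemma applicable to
  it.\<close>

definition fock_energy :: "nat \<Rightarrow> ('a measure \<Rightarrow> real) \<Rightarrow> ennreal" where
  "fock_energy n f = (\<integral>\<^sup>+y. ennreal (1 / fact n * (diff_mean P \<eta> n f y)\<^sup>2) \<partial>product_power L n)"

lemma suminf_fock_energy_span:
  assumes f: "f \<in> laplace_span L"
  shows "(\<Sum>n. fock_energy n f) = ennreal (\<integral>\<mu>. (f \<mu>)\<^sup>2 \<partial>law)"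
proof -
  have iso: "fock_isometric f f" by (intro fock_isometric_laplace_span f)
  have eq: "fock_energy n f
      = ennreal (1 / fact n * L2_inner (product_power L n) (diff_mean P \<eta> n f) (diff_mean P \<eta> n f))" for n
  proof -
    have "integrable (product_power L n) (\<lambda>y. 1 / fact n * (diff_mean P \<eta> n f y)\<^sup>2)"
      using iso by (simp add: fock_isometric_def power2_eq_square)
    then show ?thesis
      unfolding fock_energy_def
      by (subst nn_integral_eq_integral) (auto simp: L2_inner_def power2_eq_square)
  qed
  show ?thesis
    unfolding eq
    using iso by (intro suminf_ennreal_eq) (auto simp: fock_isometric_def L2_inner_def power2_eq_square)
qed

lemma suminf_fock_energy_le:
  assumes f: "f \<in> L2_space law"
  shows "(\<Sum>n. fock_energy n f) \<le> ennreal (\<integral>\<mu>. (f \<mu>)\<^sup>2 \<partial>law)"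
proof -
  have "\<exists>g\<in>laplace_span L. (\<integral>\<mu>. (f \<mu> - g \<mu>)\<^sup>2 \<partial>law) < (1 / 4) ^ k" for k :: nat
    using span_approximable_L2[OF f] by (simp add: span_approximable_def)
  then obtain F where F: "\<And>k. F k \<in> laplace_span L"
    and close: "\<And>k::nat. (\<integral>\<mu>. (f \<mu> - F k \<mu>)\<^sup>2 \<partial>law) < (1 / 4) ^ k"
    by metis
  note FL = laplace_span_L2[OF F]
  have lim: "AE y in product_power L n. (\<lambda>k. diff_mean P \<eta> n (F k) y) \<longlonglongrightarrow> diff_mean P \<eta> n f y" for n
    by (intro AE_diff_mean_tendsto f FL less_imp_le close)
  have energy: "fock_energy n f \<le> liminf (\<lambda>k. fock_energy n (F k))" for n
  proof -
    have "fock_energy n f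
        = (\<integral>\<^sup>+y. liminf (\<lambda>k. ennreal (1 / fact n * (diff_mean P \<eta> n (F k) y)\<^sup>2)) \<partial>product_power L n)"
      unfolding fock_energy_def
    proof (rule nn_integral_cong_AE)
      show "AE y in product_power L n. ennreal (1 / fact n * (diff_mean P \<eta> n f y)\<^sup>2)
          = liminf (\<lambda>k. ennreal (1 / fact n * (diff_mean P \<eta> n (F k) y)\<^sup>2))"
        using lim[of n]
      proof eventually_elim
        case (elim y)
        then have "(\<lambda>k. ennreal (1 / fact n * (diff_mean P \<eta> n (F k) y)\<^sup>2))
            \<longlonglongrightarrow> ennreal (1 / fact n * (diff_mean P \<eta> n f y)\<^sup>2)"
          by (intro tendsto_ennrealI tendsto_intros)
        then show ?case by (intro lim_imp_Liminf[symmetric]) auto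
      qed
    qed
    also have "\<dots> \<le> liminf (\<lambda>k. fock_energy n (F k))"
      unfolding fock_energy_def
    proof (rule nn_integral_liminf)
      fix k
      note [measurable] = measurable_diff_mean[OF L2_borel[OF FL], of n]
      show "(\<lambda>y. ennreal (1 / fact n * (diff_mean P \<eta> n (F k) y)\<^sup>2)) \<in> borel_measurable (product_power L n)"
        by measurable
    qed
    finally show ?thesis .
  qed
  define N where "N = (\<integral>\<mu>. (f \<mu>)\<^sup>2 \<partial>law)"
  have N: "(\<integral>\<mu>. (F k \<mu>)\<^sup>2 \<partial>law) \<le> (1 + (1 / 2) ^ k) * N + ((1 / 4) ^ k + (1 / 2) ^ k)" for k
  proof -
    \<comment> \<open>With squared error below \<open>(1 / 4) ^ k\<close>, this weight leaves the
      error term \<open>(1 / 4) ^ k + (1 / 2) ^ k\<close>, while the factor of \<open>N\<close>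
      still tends to 1.\<close>
    let ?e = "(1 / 2 :: real) ^ k"
    let ?r = "\<lambda>\<mu>. f \<mu> - F k \<mu>"
    have r: "?r \<in> L2_space law" by (intro L2_diff f FL)
    have "(\<integral>\<mu>. (F k \<mu>)\<^sup>2 \<partial>law) \<le> (\<integral>\<mu>. (1 + ?e) * (f \<mu>)\<^sup>2 + (1 + 1 / ?e) * (?r \<mu>)\<^sup>2 \<partial>law)"
    proof (rule integral_mono)
      show "(F k \<mu>)\<^sup>2 \<le> (1 + ?e) * (f \<mu>)\<^sup>2 + (1 + 1 / ?e) * (?r \<mu>)\<^sup>2" for \<mu>
        using square_add_le_weighted[of ?e "f \<mu>" "- ?r \<mu>"] by (simp add: power2_commute[of "F k \<mu>" "f \<mu>"])
    qed (use L2_integrable_square[OF FL] L2_integrable_square[OF f] L2_integrable_square[OF r] in auto)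
    also have "\<dots> = (1 + ?e) * N + (1 + 1 / ?e) * (\<integral>\<mu>. (?r \<mu>)\<^sup>2 \<partial>law)"
      unfolding N_def using L2_integrable_square[OF f] L2_integrable_square[OF r] by simp
    also have "\<dots> \<le> (1 + ?e) * N + (1 + 1 / ?e) * (1 / 4) ^ k"
      using close[of k] by (intro add_left_mono mult_left_mono) (auto simp: less_imp_le add_nonneg_nonneg)
    also have "(1 + 1 / ?e) * (1 / 4) ^ k = (1 / 4) ^ k + (1 / 2) ^ k"
      by (simp add: distrib_right power_divide flip: power_mult_distrib)
        (simp add: field_simps flip: power_mult_distrib)
    finally show ?thesis .
  qed
  have "(\<lambda>k. (1 + (1 / 2) ^ k) * N + ((1 / 4) ^ k + (1 / 2) ^ k)) \<longlonglongrightarrow> (1 + 0) * N + (0 + 0)"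
    by (intro tendsto_intros LIMSEQ_power_zero) auto
  then have limN: "(\<lambda>k. ennreal ((1 + (1 / 2) ^ k) * N + ((1 / 4) ^ k + (1 / 2) ^ k))) \<longlonglongrightarrow> ennreal N"
    by (intro tendsto_ennrealI) simp
  have "(\<Sum>n. fock_energy n f) \<le> (\<Sum>n. liminf (\<lambda>k. fock_energy n (F k)))"
    by (intro suminf_le energy) auto
  \<comment> \<open>Reading the series as an integral for counting measure permits a second use of
    Fatou's lemma, now over the order \<open>n\<close>.\<close>
  also have "\<dots> = (\<integral>\<^sup>+n. liminf (\<lambda>k. fock_energy n (F k)) \<partial>count_space UNIV)"
    by (rule nn_integral_count_space_nat[symmetric])
  also have "\<dots> \<le> liminf (\<lambda>k. \<integral>\<^sup>+n. fock_energy n (F k) \<partial>count_space UNIV)"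
    by (rule nn_integral_liminf) simp
  also have "\<dots> = liminf (\<lambda>k. ennreal (\<integral>\<mu>. (F k \<mu>)\<^sup>2 \<partial>law))"
    by (simp add: nn_integral_count_space_nat suminf_fock_energy_span F)
  also have "\<dots> \<le> liminf (\<lambda>k. ennreal ((1 + (1 / 2) ^ k) * N + ((1 / 4) ^ k + (1 / 2) ^ k)))"
    by (intro Liminf_mono always_eventually allI ennreal_leI N)
  also have "\<dots> = ennreal N"
    by (intro lim_imp_Liminf limN) auto
  finally show ?thesis by (simp add: N_def)
qed

section \<open>The real-valued form and the identity on all of L2\<close>

definition chaos_inner :: "nat \<Rightarrow> ('a measure \<Rightarrow> real) \<Rightarrow> ('a measure \<Rightarrow> real) \<Rightarrow> real" where
  "chaos_inner n f g = 1 / fact n * L2_inner (product_power L n) (diff_mean P \<eta> n f) (diff_mean P \<eta> n g)"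

lemma diff_mean_L2:
  assumes f: "f \<in> L2_space law"
  shows "diff_mean P \<eta> n f \<in> L2_space (product_power L n)"
proof -
  note m [measurable] = measurable_diff_mean[OF L2_borel[OF f], of n]
  have "fock_energy n f \<le> (\<Sum>n. fock_energy n f)"
    using sum_le_suminf[of "\<lambda>n. fock_energy n f" "{n}"] by simp
  also have "\<dots> < \<infinity>"
    using suminf_fock_energy_le[OF f] by (simp add: order_le_less_trans)
  finally have "integrable (product_power L n) (\<lambda>y. 1 / fact n * (diff_mean P \<eta> n f y)\<^sup>2)"
    unfolding fock_energy_def by (intro integrableI_nonneg) auto
  then have "integrable (product_power L n) (\<lambda>y. fact n * (1 / fact n * (diff_mean P \<eta> n f y)\<^sup>2))"
    by (rule integrable_mult_right)
  then show ?thesis using m by (simp add: L2_space_def)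
qed

lemma chaos_inner_nonneg: "0 \<le> chaos_inner n f f"
  by (simp add: chaos_inner_def L2_inner_def)

lemma fock_energy_eq_chaos_inner:
  assumes f: "f \<in> L2_space law"
  shows "fock_energy n f = ennreal (chaos_inner n f f)"
proof -
  have "fock_energy n f = ennreal (\<integral>y. 1 / fact n * (diff_mean P \<eta> n f y)\<^sup>2 \<partial>product_power L n)"
    unfolding fock_energy_def using L2_integrable_square[OF diff_mean_L2[OF f]]
    by (intro nn_integral_eq_integral) auto
  then show ?thesis by (simp add: chaos_inner_def L2_inner_def power2_eq_square)
qed

lemma
  assumes f: "f \<in> L2_space law"
  shows summable_chaos_inner: "summable (\<lambda>n. chaos_inner n f f)"
    and suminf_chaos_inner_le: "(\<Sum>n. chaos_inner n f f) \<le> (\<integral>\<mu>. (f \<mu>)\<^sup>2 \<partial>law)"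
proof -
  have le: "(\<Sum>n. ennreal (chaos_inner n f f)) \<le> ennreal (\<integral>\<mu>. (f \<mu>)\<^sup>2 \<partial>law)"
    using suminf_fock_energy_le[OF f] by (simp add: fock_energy_eq_chaos_inner[OF f])
  then show s: "summable (\<lambda>n. chaos_inner n f f)"
    by (intro summable_suminf_not_top chaos_inner_nonneg) (auto simp: top_unique)
  show "(\<Sum>n. chaos_inner n f f) \<le> (\<integral>\<mu>. (f \<mu>)\<^sup>2 \<partial>law)"
    using le unfolding suminf_ennreal2[OF chaos_inner_nonneg s]
    by (subst (asm) ennreal_le_iff) auto
qed

lemma
  assumes f: "f \<in> L2_space law" and g: "g \<in> L2_space law"
  shows AE_diff_mean_add: "AE y in product_power L n.
      diff_mean P \<eta> n (\<lambda>\<mu>. f \<mu> + g \<mu>) y = diff_mean P \<eta> n f y + diff_mean P \<eta> n g y"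
    and AE_diff_mean_diff: "AE y in product_power L n.
      diff_mean P \<eta> n (\<lambda>\<mu>. f \<mu> - g \<mu>) y = diff_mean P \<eta> n f y - diff_mean P \<eta> n g y"
proof -
  note L = diff_mean_law[OF L2_borel[OF f]] diff_mean_law[OF L2_borel[OF g]]
    diff_mean_law[OF L2_borel[OF L2_add[OF f g]]] diff_mean_law[OF L2_borel[OF L2_diff[OF f g]]]
  show "AE y in product_power L n.
      diff_mean P \<eta> n (\<lambda>\<mu>. f \<mu> + g \<mu>) y = diff_mean P \<eta> n f y + diff_mean P \<eta> n g y"
    using AE_integrable_diff_ops[OF f, of n] AE_integrable_diff_ops[OF g, of n]
    by eventually_elim (simp add: L diff_ops_add)
  show "AE y in product_power L n.
      diff_mean P \<eta> n (\<lambda>\<mu>. f \<mu> - g \<mu>) y = diff_mean P \<eta> n f y - diff_mean P \<eta> n g y"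
    using AE_integrable_diff_ops[OF f, of n] AE_integrable_diff_ops[OF g, of n]
    by eventually_elim (simp add: L diff_ops_diff)
qed

text \<open>Linearity of \<open>T_n\<close> holds almost everywhere, which the integrals do not
  notice. Added together, the two expansions give the parallelogram law for the defect; subtracted,
  they give polarization.\<close>

lemma
  assumes f: "f \<in> L2_space law" and g: "g \<in> L2_space law"
  shows chaos_inner_add: "chaos_inner n (\<lambda>\<mu>. f \<mu> + g \<mu>) (\<lambda>\<mu>. f \<mu> + g \<mu>)
      = chaos_inner n f f + chaos_inner n g g + 2 * chaos_inner n f g"
    and chaos_inner_diff: "chaos_inner n (\<lambda>\<mu>. f \<mu> - g \<mu>) (\<lambda>\<mu>. f \<mu> - g \<mu>)
      = chaos_inner n f f + chaos_inner n g g - 2 * chaos_inner n f g"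
proof -
  let ?T = "diff_mean P \<eta> n" and ?L = "product_power L n"
  have i: "integrable ?L (\<lambda>y. ?T f y * ?T f y)" "integrable ?L (\<lambda>y. ?T g y * ?T g y)"
    "integrable ?L (\<lambda>y. ?T f y * ?T g y)"
    by (intro L2_integrable_mult diff_mean_L2 f g)+
  note m = L2_measurable[OF diff_mean_L2[OF f], of n] L2_measurable[OF diff_mean_L2[OF g], of n]
    L2_measurable[OF diff_mean_L2[OF L2_add[OF f g]], of n] L2_measurable[OF diff_mean_L2[OF L2_diff[OF f g]], of n]
  have "L2_inner ?L (?T (\<lambda>\<mu>. f \<mu> + g \<mu>)) (?T (\<lambda>\<mu>. f \<mu> + g \<mu>))
      = (\<integral>y. ?T f y * ?T f y + ?T g y * ?T g y + 2 * (?T f y * ?T g y) \<partial>?L)"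
    unfolding L2_inner_def
  proof (rule integral_cong_AE)
    show "AE y in ?L. ?T (\<lambda>\<mu>. f \<mu> + g \<mu>) y * ?T (\<lambda>\<mu>. f \<mu> + g \<mu>) y
        = ?T f y * ?T f y + ?T g y * ?T g y + 2 * (?T f y * ?T g y)"
      using AE_diff_mean_add[OF f g, of n] by eventually_elim (simp only:, simp add: algebra_simps)
  qed (intro borel_measurable_times borel_measurable_add borel_measurable_const m)+
  then show "chaos_inner n (\<lambda>\<mu>. f \<mu> + g \<mu>) (\<lambda>\<mu>. f \<mu> + g \<mu>)
      = chaos_inner n f f + chaos_inner n g g + 2 * chaos_inner n f g"
    using i by (simp add: chaos_inner_def L2_inner_def add_divide_distrib)
  have "L2_inner ?L (?T (\<lambda>\<mu>. f \<mu> - g \<mu>)) (?T (\<lambda>\<mu>. f \<mu> - g \<mu>))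
      = (\<integral>y. ?T f y * ?T f y + ?T g y * ?T g y - 2 * (?T f y * ?T g y) \<partial>?L)"
    unfolding L2_inner_def
  proof (rule integral_cong_AE)
    show "AE y in ?L. ?T (\<lambda>\<mu>. f \<mu> - g \<mu>) y * ?T (\<lambda>\<mu>. f \<mu> - g \<mu>) y
        = ?T f y * ?T f y + ?T g y * ?T g y - 2 * (?T f y * ?T g y)"
      using AE_diff_mean_diff[OF f g, of n] by eventually_elim (simp only:, simp add: algebra_simps)
  qed (intro borel_measurable_times borel_measurable_add borel_measurable_diff borel_measurable_const m)+
  then show "chaos_inner n (\<lambda>\<mu>. f \<mu> - g \<mu>) (\<lambda>\<mu>. f \<mu> - g \<mu>)
      = chaos_inner n f f + chaos_inner n g g - 2 * chaos_inner n f g"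
    using i by (simp add: chaos_inner_def L2_inner_def add_divide_distrib diff_divide_distrib)
qed

lemma
  assumes f: "f \<in> L2_space law" and g: "g \<in> L2_space law"
  shows integral_square_add: "(\<integral>\<mu>. (f \<mu> + g \<mu>)\<^sup>2 \<partial>law)
      = (\<integral>\<mu>. (f \<mu>)\<^sup>2 \<partial>law) + (\<integral>\<mu>. (g \<mu>)\<^sup>2 \<partial>law) + 2 * (\<integral>\<mu>. f \<mu> * g \<mu> \<partial>law)"
    and integral_square_diff: "(\<integral>\<mu>. (f \<mu> - g \<mu>)\<^sup>2 \<partial>law)
      = (\<integral>\<mu>. (f \<mu>)\<^sup>2 \<partial>law) + (\<integral>\<mu>. (g \<mu>)\<^sup>2 \<partial>law) - 2 * (\<integral>\<mu>. f \<mu> * g \<mu> \<partial>law)"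
  using L2_integrable_square[OF f] L2_integrable_square[OF g] L2_integrable_mult[OF f g]
  by (simp_all add: power2_sum power2_diff mult.assoc)

text \<open>The defect \<open>d\<close> is handled through the parallelogram law alone, so its
  bilinear form and a Cauchy-Schwarz inequality for it never appear.\<close>

lemma suminf_chaos_inner_square:
  assumes f: "f \<in> L2_space law"
  shows "(\<Sum>n. chaos_inner n f f) = (\<integral>\<mu>. (f \<mu>)\<^sup>2 \<partial>law)"
proof -
  define d where "d f = (\<integral>\<mu>. (f \<mu>)\<^sup>2 \<partial>law) - (\<Sum>n. chaos_inner n f f)" for f
  have d_nonneg: "0 \<le> d f" if "f \<in> L2_space law" for f
    using suminf_chaos_inner_le[OF that] by (simp add: d_def)
  have d_le: "d f \<le> (\<integral>\<mu>. (f \<mu>)\<^sup>2 \<partial>law)" if "f \<in> L2_space law" for f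
    using suminf_nonneg[OF summable_chaos_inner[OF that] chaos_inner_nonneg] by (simp add: d_def)
  have d_parallelogram: "d (\<lambda>\<mu>. f \<mu> + g \<mu>) + d (\<lambda>\<mu>. f \<mu> - g \<mu>) = 2 * d f + 2 * d g"
    if f: "f \<in> L2_space law" and g: "g \<in> L2_space law" for f g
  proof -
    note s = summable_chaos_inner[OF f] summable_chaos_inner[OF g]
      summable_chaos_inner[OF L2_add[OF f g]] summable_chaos_inner[OF L2_diff[OF f g]]
    have "(\<Sum>n. chaos_inner n (\<lambda>\<mu>. f \<mu> + g \<mu>) (\<lambda>\<mu>. f \<mu> + g \<mu>))
        + (\<Sum>n. chaos_inner n (\<lambda>\<mu>. f \<mu> - g \<mu>) (\<lambda>\<mu>. f \<mu> - g \<mu>))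
        = (\<Sum>n. 2 * chaos_inner n f f + 2 * chaos_inner n g g)"
      unfolding suminf_add[OF s(3,4)]
      by (simp add: chaos_inner_add[OF f g] chaos_inner_diff[OF f g])
    also have "\<dots> = 2 * (\<Sum>n. chaos_inner n f f) + 2 * (\<Sum>n. chaos_inner n g g)"
      using s by (simp add: suminf_add[symmetric] summable_mult suminf_mult)
    finally show ?thesis
      by (simp add: d_def integral_square_add[OF f g] integral_square_diff[OF f g])
  qed
  have "d f \<le> \<epsilon>" if \<epsilon>: "0 < \<epsilon>" for \<epsilon>
  proof -
    obtain g where g: "g \<in> laplace_span L" and close: "(\<integral>\<mu>. (f \<mu> - g \<mu>)\<^sup>2 \<partial>law) < \<epsilon> / 2"
      using span_approximable_L2[OF f] \<epsilon> unfolding span_approximable_def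
      by (meson divide_pos_pos zero_less_numeral)
    note gL = laplace_span_L2[OF g]
    let ?r = "\<lambda>\<mu>. f \<mu> - g \<mu>"
    have r: "?r \<in> L2_space law" by (intro L2_diff f gL)
    have dg: "d g = 0"
      using fock_isometric_laplace_span[OF g g]
      by (simp add: d_def fock_isometric_def sums_iff chaos_inner_def power2_eq_square)
    \<comment> \<open>Since \<open>f = g + (f - g)\<close> and \<open>d g = 0\<close>, the
      parallelogram law leaves only the defect of the error on the right. Discarding the nonnegative
      second summand gives \<open>d f \<le> 2 * d ?r\<close>; the factor 2 explains the tolerance
      \<open>\<epsilon> / 2\<close>.\<close>
    have "d f + d (\<lambda>\<mu>. g \<mu> - ?r \<mu>) = 2 * d ?r"
      using d_parallelogram[OF gL r] dg by simp
    then have "d f \<le> 2 * d ?r"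
      using d_nonneg[OF L2_diff[OF gL r]] by linarith
    also have "\<dots> \<le> \<epsilon>" using d_le[OF r] close by linarith
    finally show ?thesis .
  qed
  then have "d f \<le> 0" by (rule field_le_epsilon[of "d f" 0, simplified])
  with d_nonneg[OF f] show ?thesis by (simp add: d_def)
qed

lemma chaos_inner_sums:
  assumes f: "f \<in> L2_space law" and g: "g \<in> L2_space law"
  shows "(\<lambda>n. chaos_inner n f g) sums (\<integral>\<mu>. f \<mu> * g \<mu> \<partial>law)"
proof -
  have sq: "(\<lambda>n. chaos_inner n h h) sums (\<integral>\<mu>. (h \<mu>)\<^sup>2 \<partial>law)" if "h \<in> L2_space law" for h
    using summable_chaos_inner[OF that] suminf_chaos_inner_square[OF that] by (simp add: sums_iff)
  have "(\<lambda>n. 1 / 4 * (chaos_inner n (\<lambda>\<mu>. f \<mu> + g \<mu>) (\<lambda>\<mu>. f \<mu> + g \<mu>)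
        - chaos_inner n (\<lambda>\<mu>. f \<mu> - g \<mu>) (\<lambda>\<mu>. f \<mu> - g \<mu>)))
      sums (1 / 4 * ((\<integral>\<mu>. (f \<mu> + g \<mu>)\<^sup>2 \<partial>law) - (\<integral>\<mu>. (f \<mu> - g \<mu>)\<^sup>2 \<partial>law)))"
    by (intro sums_mult sums_diff sq L2_add L2_diff f g)
  then show ?thesis
    by (simp add: chaos_inner_add[OF f g] chaos_inner_diff[OF f g]
        integral_square_add[OF f g] integral_square_diff[OF f g])
qed

text \<open>The product over the empty index set is a single point of mass 1, on which
  \<open>T_0 f\<close> is the expectation. This identifies the leading term of the series.\<close>

lemma chaos_inner_0:
  assumes f: "f \<in> L2_space law" and g: "g \<in> L2_space law"
  shows "chaos_inner 0 f g = (\<integral>\<mu>. f \<mu> \<partial>law) * (\<integral>\<mu>. g \<mu> \<partial>law)"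
proof -
  have "measure (product_power L 0) (space (product_power L 0)) = 1"
    by (simp add: product_power_def space_PiM measure_def)
  then show ?thesis
    by (simp add: chaos_inner_def L2_inner_def diff_mean_law[OF L2_borel[OF f]] diff_mean_law[OF L2_borel[OF g]])
qed

lemma
  assumes f: "f \<in> L2_space law" and g: "g \<in> L2_space law"
  shows summable_chaos_inner_Suc: "summable (\<lambda>n. chaos_inner (Suc n) f g)"
    and expectation_mult_eq: "(\<integral>\<omega>. f (\<eta> \<omega>) * g (\<eta> \<omega>) \<partial>P)
      = (\<integral>\<omega>. f (\<eta> \<omega>) \<partial>P) * (\<integral>\<omega>. g (\<eta> \<omega>) \<partial>P) + (\<Sum>n. chaos_inner (Suc n) f g)"
proof -
  have "(\<integral>\<omega>. h (\<eta> \<omega>) \<partial>P) = (\<integral>\<mu>. h \<mu> \<partial>law)" if "h \<in> borel_measurable (counting_algebra L)" for h :: "'a measure \<Rightarrow> real"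
    by (rule integral_distr[OF measurable_process that, symmetric])
  note E = this[OF L2_borel[OF f]] this[OF L2_borel[OF g]] this[OF borel_measurable_times[OF L2_borel[OF f] L2_borel[OF g]]]
  note s = chaos_inner_sums[OF f g]
  show "summable (\<lambda>n. chaos_inner (Suc n) f g)"
    using sums_summable[OF s] by (subst summable_Suc_iff)
  show "(\<integral>\<omega>. f (\<eta> \<omega>) * g (\<eta> \<omega>) \<partial>P)
      = (\<integral>\<omega>. f (\<eta> \<omega>) \<partial>P) * (\<integral>\<omega>. g (\<eta> \<omega>) \<partial>P) + (\<Sum>n. chaos_inner (Suc n) f g)"
    unfolding E using s suminf_split_head[of "\<lambda>n. chaos_inner n f g"] chaos_inner_0[OF f g]
    by (simp add: sums_iff)
qed

end

text \<open>Integrability, membership in L2 and summability accompany the identities, so that they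
  cannot rest on default values of integrals or series.\<close>

theorem theorem1p1:
  fixes P :: "'w measure" and L :: "'a measure" and \<eta> :: "'w \<Rightarrow> 'a measure"
    and f :: "'a measure \<Rightarrow> real"
  assumes "poisson_process P L \<eta>"
    and "f \<in> L2_space (distr P (counting_algebra L) \<eta>)"
  shows "(\<forall>n\<ge>1.
            (AE y in product_power L n. integrable P (\<lambda>\<omega>. diff_ops (map y [0..<n]) f (\<eta> \<omega>))) \<and>
            diff_mean P \<eta> n f \<in> L2_space (product_power L n)) \<and>
         (let a = (\<lambda>n. 1 / fact n * (L2_norm (product_power L n) (diff_mean P \<eta> n f))\<^sup>2)
          in summable (\<lambda>n. a (Suc n)) \<and>
             (\<integral>\<omega>. (f (\<eta> \<omega>))\<^sup>2 \<partial>P) = (\<integral>\<omega>. f (\<eta> \<omega>) \<partial>P)\<^sup>2 + (\<Sum>n. a (Suc n))) \<and>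
         (\<forall>g \<in> L2_space (distr P (counting_algebra L) \<eta>).
            let b = (\<lambda>n. 1 / fact n *
                       L2_inner (product_power L n) (diff_mean P \<eta> n f) (diff_mean P \<eta> n g))
            in summable (\<lambda>n. b (Suc n)) \<and>
               (\<integral>\<omega>. f (\<eta> \<omega>) * g (\<eta> \<omega>) \<partial>P)
                 = (\<integral>\<omega>. f (\<eta> \<omega>) \<partial>P) * (\<integral>\<omega>. g (\<eta> \<omega>) \<partial>P) + (\<Sum>n. b (Suc n)))"
proof -
  interpret poisson_process P L \<eta> by fact
  note f = assms(2)
  have norm: "(L2_norm M h)\<^sup>2 = L2_inner M h h" for M :: "(nat \<Rightarrow> 'a) measure" and h
    by (simp add: L2_norm_def L2_inner_def)
  have int: "AE y in product_power L n. integrable P (\<lambda>\<omega>. diff_ops (map y [0..<n]) f (\<eta> \<omega>))" for n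
    using AE_integrable_diff_ops[OF f, of n]
    by eventually_elim
      (simp add: integrable_distr_eq[OF measurable_process measurable_diff_ops[OF L2_borel[OF f]]])
  have b: "summable (\<lambda>n. 1 / fact (Suc n) *
        L2_inner (product_power L (Suc n)) (diff_mean P \<eta> (Suc n) f) (diff_mean P \<eta> (Suc n) g)) \<and>
      (\<integral>\<omega>. f (\<eta> \<omega>) * g (\<eta> \<omega>) \<partial>P)
        = (\<integral>\<omega>. f (\<eta> \<omega>) \<partial>P) * (\<integral>\<omega>. g (\<eta> \<omega>) \<partial>P) + (\<Sum>n. 1 / fact (Suc n) *
        L2_inner (product_power L (Suc n)) (diff_mean P \<eta> (Suc n) f) (diff_mean P \<eta> (Suc n) g))"
    if g: "g \<in> L2_space law" for g
    using summable_chaos_inner_Suc[OF f g] expectation_mult_eq[OF f g] unfolding chaos_inner_def by blast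
  show ?thesis
    unfolding Let_def norm
    using b[OF f] b int diff_mean_L2[OF f] by (simp only: power2_eq_square) blast
qed

end
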